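(* Let $f:\mathbb{R}\times\mathbb{R}\to\mathbb{R}$ satisfy the KPP assumptions (a)-(c) of the context and consider the lattice equation $$\dot u_i(t)=u_{i+1}(t)-2u_i(t)+u_{i-1}(t)+u_i(t)f(t,u_i(t)),\qquad i\in\mathbb{Z}.\qquad (L)$$ (1) There is a unique spatially homogeneous entire positive solution $u^+(t)$ of (L), and it is globally stable in the sense that for any $u^0\in l^\infty(\mathbb{Z})$ with $\inf_{i\in\mathbb{Z}}u^0_i>0$, $$\|u(t+s;s,u^0)-u^+(t+s)\|_\infty\to 0\quad\text{as } t\to\infty,\ \text{uniformly in } s\in\mathbb{R}.$$ (2) Let $u^0\in l^\infty(\mathbb{Z})$ with $u^0_i\ge 0$ for all $i\in\mathbb{Z}$ and let $\gamma'>0$ be given. If $$\liminf_{t\to\infty}\ \inf_{i\in\mathbb{Z},\,|i|\le\gamma' t}u_i(t;0,u^0)>0,$$ then for any $0<\gamma<\gamma'$, $$\limsup_{t\to\infty}\ \sup_{i\in\mathbb{Z},\,|i|\le\gamma t}|u_i(t;0,u^0)-u^+(t)|=0.$$ If $$\liminf_{t\to\infty}\ \inf_{s\in\mathbb{R},\,i\in\mathbb{Z},\,|i|\le\gamma' t}u_i(t+s;s,u^0)>0,$$ then for any $0<\gamma<\gamma'$, $$\limsup_{t\to\infty}\ \sup_{i\in\mathbb{Z},\,|i|\le\gamma t}|u_i(t+s;s,u^0)-u^+(t+s)|=0\quad\text{uniformly in } s\in\mathbb{R}.$$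
   Context: KPP assumptions on $f:\mathbb{R}\times\mathbb{R}\to\mathbb{R}$, $(t,u)\mapsto f(t,u)$: (a) $f(t,u)$ is locally Hölder continuous in $t\in\mathbb{R}$, Lipschitz continuous in $u\in\mathbb{R}$, and continuously differentiable in $u$ for $u\ge 0$. (b) For each $u\in\mathbb{R}$, $f(\cdot,u)\in L^\infty(\mathbb{R})$; there is $M_0>0$ with $f(t,u)<0$ for all $t$ and all $u\ge M_0$; $f_u(t,u)<0$ for $u\ge 0$; and $\liminf_{t-s\to\infty}\frac{1}{t-s}\int_s^t f(\tau,0)\,d\tau>0$. (c) There are $0<\tilde m_0<\tilde M_0$ such that $f(t,0)-\tilde M_0u\le f(t,u)\le f(t,0)-\tilde m_0u$ for all $t\in\mathbb{R}$, $u\ge 0$. $l^\infty(\mathbb{Z})$ is the space of bounded real sequences $u=\{u_i\}_{i\in\mathbb{Z}}$ with $\|u\|_\infty=\sup_i|u_i|$. For $u^0\in l^\infty(\mathbb{Z})$ and $s\in\mathbb{R}$, $u(t;s,u^0)=\{u_i(t;s,u^0)\}_{i\in\mathbb{Z}}$ denotes the unique solution of (L) with $u(s;s,u^0)=u^0$; if $u^0_i\ge 0$ for all $i$ it exists and is nonnegative for all $t\ge s$. A solution $u(t)=\{u_i(t)\}$ of (L) is an entire positive solution if it is a solution for all $t\in\mathbb{R}$ and $\inf_{t\in\mathbb{R},i\in\mathbb{Z}}u_i(t)>0$. It is spatially homogeneous if $u_i(t)=u_j(t)$ for all $i,j\in\mathbb{Z}$; such a solution is identified with the scalar function $u^+(t)$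 equal to all its components.
   Formalization: In (b), f_u<0 is assumed uniformly in t for each fixed u≥0 (sup over t of f_u(t,u) is negative), since with pointwise negativity the stability in (1) fails; in (a), the Lipschitz constant in u is taken uniform for t in compact intervals. *)

theory Defs
  imports "HOL-Analysis.Analysis"
begin

text \<open>
  The integers carry the discrete topology, so every function on them is continuous and the
  bounded continuous functions with the supremum norm are exactly the bounded sequences
  indexed by the integers.
\<close>

type_synonym linf = "int \<Rightarrow>\<^sub>C real"

definition locally_hoelder :: "(real \<Rightarrow> real) \<Rightarrow> bool" where
  "locally_hoelder g \<longleftrightarrow>
     (\<forall>t0. \<exists>\<delta>>0. \<exists>\<alpha>. 0 < \<alpha> \<and> \<alpha> \<le> 1 \<and> (\<exists>C. \<forall>t\<in>ball t0 \<delta>. \<forall>t'\<in>ball t0 \<delta>.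
        \<bar>g t - g t'\<bar> \<le> C * \<bar>t - t'\<bar> powr \<alpha>))"

text \<open>The partial derivative in \<open>u\<close> for \<open>u \<ge> 0\<close>; it is one-sided at \<open>u = 0\<close>.\<close>

definition partial_u :: "(real \<Rightarrow> real \<Rightarrow> real) \<Rightarrow> real \<Rightarrow> real \<Rightarrow> real" where
  "partial_u f t u = vector_derivative (f t) (at u within {0..})"

text \<open>
  The Lipschitz constant in \<open>u\<close> is uniform for \<open>t\<close> in compact intervals (a constant that is
  allowed to vary arbitrarily with \<open>t\<close> would not give unique solvability of the initial value
  problem).
\<close>

definition KPP_a :: "(real \<Rightarrow> real \<Rightarrow> real) \<Rightarrow> bool" where
  "KPP_a f \<longleftrightarrow>
     (\<forall>u. locally_hoelder (\<lambda>t. f t u)) \<and>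
     (\<forall>a b. \<exists>L. \<forall>t\<in>{a..b}. L-lipschitz_on UNIV (f t)) \<and>
     (\<forall>t. f t differentiable_on {0..} \<and> continuous_on {0..} (partial_u f t))"

text \<open>
  Since \<open>f\<close> is continuous in \<open>t\<close>, essential boundedness in \<open>t\<close> is boundedness.  The condition
  that the derivative in \<open>u\<close> is negative is imposed uniformly in \<open>t\<close> (for each fixed \<open>u\<close>).
  Without uniformity stability fails: let \<open>f t u = g u - h t * u\<close> with
  \<open>h t = exp (- max 0 t)\<close> and a suitable nonincreasing, continuously differentiable \<open>g\<close> that vanishes on
  \<open>{1..2}\<close>; spatially constant solutions starting in that interval at a large time essentially
  stay where they are.
  The limit inferior is taken over pairs \<open>(s, t)\<close> along \<open>t - s \<rightarrow> \<infinity>\<close>.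
\<close>

definition KPP_b :: "(real \<Rightarrow> real \<Rightarrow> real) \<Rightarrow> bool" where
  "KPP_b f \<longleftrightarrow>
     (\<forall>u. bounded (range (\<lambda>t. f t u))) \<and>
     (\<exists>M0>0. \<forall>t. \<forall>u\<ge>M0. f t u < 0) \<and>
     (\<forall>u\<ge>0. \<exists>c>0. \<forall>t. partial_u f t u \<le> - c) \<and>
     Liminf (filtercomap (\<lambda>(s, t). t - s) at_top)
       (\<lambda>(s, t). ereal (1 / (t - s) * integral {s..t} (\<lambda>\<tau>. f \<tau> 0))) > 0"

definition KPP_c :: "(real \<Rightarrow> real \<Rightarrow> real) \<Rightarrow> bool" where
  "KPP_c f \<longleftrightarrow>
     (\<exists>m M. 0 < m \<and> m < M \<and>
        (\<forall>t. \<forall>u\<ge>0. f t 0 - M * u \<le> f t u \<and> f t u \<le> f t 0 - m * u))"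

text \<open>
  A solution on a time interval is a continuous curve in the space of bounded sequences that
  satisfies the lattice equation in every component.  Continuity in the supremum norm makes
  solutions of the initial value problem unique.
\<close>

definition lattice_solution ::
    "(real \<Rightarrow> real \<Rightarrow> real) \<Rightarrow> real set \<Rightarrow> (real \<Rightarrow> linf) \<Rightarrow> bool" where
  "lattice_solution f I u \<longleftrightarrow>
     continuous_on I u \<and>
     (\<forall>t\<in>I. \<forall>i. ((\<lambda>t. u t i) has_real_derivative
        (u t (i + 1) - 2 * u t i + u t (i - 1) + u t i * f t (u t i))) (at t within I))"

text \<open>
  The value at time \<open>t\<close> of the solution that starts from \<open>u0\<close> at time \<open>s\<close>.  It is only
  meaningful for \<open>t \<ge> s\<close> within the interval of existence.
\<close>

definition solution_from ::
    "(real \<Rightarrow> real \<Rightarrow> real) \<Rightarrow> real \<Rightarrow> linf \<Rightarrow> real \<Rightarrow> linf" where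
  "solution_from f s u0 t = (THE x. \<exists>u. lattice_solution f {s..t} u \<and> u s = u0 \<and> u t = x)"

definition entire_positive_solution ::
    "(real \<Rightarrow> real \<Rightarrow> real) \<Rightarrow> (real \<Rightarrow> linf) \<Rightarrow> bool" where
  "entire_positive_solution f u \<longleftrightarrow>
     lattice_solution f UNIV u \<and> (INF t. INF i. ereal (u t i)) > 0"

definition spatially_homogeneous :: "(real \<Rightarrow> linf) \<Rightarrow> bool" where
  "spatially_homogeneous u \<longleftrightarrow> (\<forall>t i j. u t i = u t j)"

definition sites_within :: "real \<Rightarrow> int set" where
  "sites_within r = {i. \<bar>real_of_int i\<bar> \<le> r}"

end

theory Submission
  imports Defs
begin

text \<open>
  Everything rests on a maximum principle for the lattice that only uses the differential
  inequality where the function is positive.  Since \<open>f\<close> decreases in \<open>u\<close>, the reaction term is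
  one-sided Lipschitz on \<open>u \<ge> 0\<close> uniformly in time, so sub- and supersolutions are ordered although
  the two-sided Lipschitz constant of \<open>f\<close> may be unbounded in time.

  A bounded entire solution \<open>V\<close> is the pullback limit of scalar solutions starting from a constant
  supersolution; averaging \<open>f t 0\<close> yields a positive entire subsolution that keeps the limit away
  from zero.  By Baire's theorem the pointwise bounds on the derivative in \<open>u\<close> give a gap
  \<open>f t y \<le> f t x - \<eta>\<close> that is uniform in \<open>t\<close> for \<open>x + d \<le> y\<close>.  Hence \<open>V * exp \<theta>\<close> and \<open>V * exp (- \<theta>)\<close> are a
  super- and a subsolution while \<open>\<theta>\<close> decreases at rate \<open>\<eta>\<close> down to \<open>\<epsilon>\<close>, which squeezes every
  solution that is bounded away from zero onto \<open>V\<close> within a time independent of the starting time.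
  For the spreading statements one waits a fixed time \<open>\<tau>\<close> and pays for the region outside the
  window, which is at distance tending to infinity, with a quadratically growing solution of the
  linear equation.
\<close>

section \<open>Maximum principle and initial value problems\<close>

text \<open>At a positive maximum the discrete Laplacian cannot compensate the growth of an
  exponential weight. The one-sided form, with \<open>w\<close> bounded from above and the
  inequality imposed at positive values, allows differences \<open>v - u\<close> in which a
  nonnegative \<open>u\<close> grows without bound in space.\<close>

lemma lattice_maximum_principle:
  fixes w w' :: "real \<Rightarrow> int \<Rightarrow> real"
  assumes bound: "\<And>t i. t \<in> {a..b} \<Longrightarrow> w t i \<le> B"
    and deriv: "\<And>t i. t \<in> {a..b} \<Longrightarrow> ((\<lambda>t. w t i) has_real_derivative w' t i) (at t within {a..b})"
    and ineq: "\<And>t i. t \<in> {a..b} \<Longrightarrow> w t i > 0 \<Longrightarrow>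
                 w' t i \<le> w t (i + 1) - 2 * w t i + w t (i - 1) + K * w t i"
    and init: "\<And>i. w a i \<le> 0"
    and t: "t \<in> {a..b}"
  shows "w t i \<le> 0"
proof (rule ccontr)
  assume "\<not> w t i \<le> 0"
  then have pos: "w t i > 0" by simp
  txt \<open>Dividing by the weight \<open>p j * exp ((K + 3) * (s - a))\<close>, a strict supersolution of the linear equation, makes the
    positive maximum attained although the lattice is infinite.\<close>
  define p :: "int \<Rightarrow> real" where "p j = 1 + (real_of_int j)^2" for j
  have p1: "p j \<ge> 1" for j by (simp add: p_def)
  then have p0: "p j > 0" for j using less_le_trans[OF zero_less_one] by blast
  \<comment> \<open>Since \<open>p (j + 1) + p (j - 1) = 2 * p j + 2 \<le> 4 * p j\<close>, the rate
    \<open>K + 2\<close> would be borderline at \<open>j = 0\<close>; the extra unit leads to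
    \<open>5 * p j \<le> 2 * p j + 2\<close>, which contradicts \<open>p j \<ge> 1\<close>.\<close>
  define E where "E s = exp (- (K + 3) * (s - a))" for s
  have E0: "E s > 0" for s by (simp add: E_def)
  define r where "r s j = w s j * E s / p j" for s j
  define r' where "r' s j = (w' s j - (K + 3) * w s j) * E s / p j" for s j
  have dr: "((\<lambda>s. r s j) has_real_derivative r' s j) (at s within {a..b})" if "s \<in> {a..b}" for s j
    unfolding r_def r'_def E_def using p0[of j]
    by (auto intro!: derivative_eq_intros deriv[OF that] simp: field_simps)
  have cr: "continuous_on {a..b} (\<lambda>s. r s j)" for j
    using dr by (meson DERIV_continuous_on)
  define E1 where "E1 = exp (\<bar>K + 3\<bar> * (b - a))"
  have EE1: "E s \<le> E1" if "s \<in> {a..b}" for s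
  proof -
    have "- (K + 3) * (s - a) \<le> \<bar>K + 3\<bar> * (b - a)"
      using that t by (intro mult_mono) auto
    then show ?thesis by (simp add: E_def E1_def)
  qed
  have B0: "B > 0" using pos bound[OF t, of i] by linarith
  have rt: "r t i > 0" using pos E0[of t] p0[of i] by (simp add: r_def)
  \<comment> \<open>Beyond \<open>N\<close> the weight alone pushes \<open>r\<close> below the
    positive value \<open>r t i\<close>, so only the finitely many sites in \<open>I\<close> compete
    for the maximum.\<close>
  obtain N :: nat where N: "real N > B * E1 / r t i" using reals_Archimedean2 by blast
  define I where "I = insert i {- int N..int N}"
  have finI: "finite I" "I \<noteq> {}" by (auto simp: I_def)
  have outside: "r s j < r t i" if "s \<in> {a..b}" "j \<notin> I" for s j
  proof -
    have "\<bar>j\<bar> > int N" using that by (auto simp: I_def)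
    then have j: "real N < \<bar>real_of_int j\<bar>" by linarith
    have "\<bar>real_of_int j\<bar> \<le> p j" unfolding p_def
      using sum_squares_bound[of 1 "\<bar>real_of_int j\<bar>"] by simp
    then have "B * E1 / r t i < p j" using N j by linarith
    then have "B * E1 < r t i * p j" using rt by (simp add: field_simps)
    moreover have "w s j * E s \<le> B * E1"
      using bound[OF that(1), of j] EE1[OF that(1)] E0[of s] B0
      by (meson less_imp_le mult_mono' mult_right_mono mult_left_mono order_trans)
    ultimately show ?thesis using p0[of j] by (simp add: r_def field_simps)
  qed
  have "\<exists>s. s \<in> {a..b} \<and> (\<forall>s'\<in>{a..b}. r s' j \<le> r s j)" for j
    using continuous_attains_sup[OF compact_Icc _ cr[of j]] t by blast
  then obtain S where S: "\<And>j. S j \<in> {a..b}" "\<And>j s'. s' \<in> {a..b} \<Longrightarrow> r s' j \<le> r (S j) j"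
    by metis
  have "Max ((\<lambda>j. r (S j) j) ` I) \<in> (\<lambda>j. r (S j) j) ` I" using finI by (intro Max_in) auto
  then obtain j1 where j1: "j1 \<in> I" "Max ((\<lambda>j. r (S j) j) ` I) = r (S j1) j1" by auto
  have j1max: "r (S j) j \<le> r (S j1) j1" if "j \<in> I" for j
    unfolding j1(2)[symmetric] using that finI by (intro Max_ge) auto
  define t1 where "t1 = S j1"
  define m where "m = r t1 j1"
  have t1: "t1 \<in> {a..b}" using S by (simp add: t1_def)
  have rm: "r t i \<le> m" using j1max[of i] S(2)[OF t, of i] by (auto simp: m_def t1_def I_def)
  have max: "r s j \<le> m" if "s \<in> {a..b}" for s j
    using outside[OF that, of j] rm j1max[of j] S(2)[OF that, of j]
    by (cases "j \<in> I") (auto simp: m_def t1_def)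
  have m0: "m > 0" using rm rt by linarith
  have wle: "w t1 j * E t1 \<le> m * p j" for j
    using max[OF t1, of j] p0[of j] by (simp add: r_def field_simps)
  have weq: "w t1 j1 * E t1 = m * p j1"
    using p0[of j1] by (simp add: m_def r_def)
  have wpos: "w t1 j1 > 0"
    using weq m0 p0[of j1] E0[of t1] by (metis mult_pos_pos zero_less_mult_pos2)
  have "t1 \<noteq> a" using wpos init[of j1] by auto
  then have at1: "a < t1" using t1 by simp
  \<comment> \<open>The maximum may sit at the right end \<open>b\<close>, so the derivative is
    tested by steps backwards in time; these stay in the interval because
    \<open>a < t1\<close>.\<close>
  have "r' t1 j1 \<ge> 0"
  proof (rule ccontr)
    assume "\<not> r' t1 j1 \<ge> 0"
    then obtain d where d: "d > 0" "\<And>h. h > 0 \<Longrightarrow> t1 - h \<in> {a..b} \<Longrightarrow> h < d \<Longrightarrow> r t1 j1 < r (t1 - h) j1"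
      using has_real_derivative_neg_dec_left[OF dr[OF t1, of j1]] by auto
    define h where "h = min (d/2) (t1 - a)"
    have "h > 0" "h < d" "t1 - h \<in> {a..b}" using d(1) at1 t1 by (auto simp: h_def)
    then show False using d(2)[of h] max[of "t1 - h" j1] by (simp add: m_def)
  qed
  then have "(K + 3) * w t1 j1 \<le> w' t1 j1"
    using E0[of t1] p0[of j1] by (auto simp: r'_def zero_le_mult_iff zero_le_divide_iff)
  also have "\<dots> \<le> w t1 (j1 + 1) - 2 * w t1 j1 + w t1 (j1 - 1) + K * w t1 j1"
    using ineq[OF t1 wpos] .
  finally have "5 * w t1 j1 \<le> w t1 (j1 + 1) + w t1 (j1 - 1)" by (simp add: algebra_simps)
  then have "5 * w t1 j1 * E t1 \<le> (w t1 (j1 + 1) + w t1 (j1 - 1)) * E t1"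
    using E0[of t1] by simp
  then have "5 * (m * p j1) \<le> w t1 (j1 + 1) * E t1 + w t1 (j1 - 1) * E t1"
    using weq by (simp add: algebra_simps)
  also have "\<dots> \<le> m * p (j1 + 1) + m * p (j1 - 1)" by (intro add_mono wle)
  also have "\<dots> = m * (2 * p j1 + 2)" by (simp add: p_def algebra_simps power2_eq_square)
  finally have "5 * p j1 \<le> 2 * p j1 + 2" using m0 by (simp add: algebra_simps)
  then show False using p1[of j1] by linarith
qed

text \<open>A global Lipschitz constant rules out blow-up, so one fixed point argument covers all of
  \<open>{a..b}\<close>. The general Banach space makes it applicable to curves in
  \<open>linf\<close>.\<close>

lemma picard_lindeloef_lipschitz:
  fixes F :: "real \<Rightarrow> 'a::banach \<Rightarrow> 'a"
  assumes ab: "a \<le> b"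
    and lip: "\<And>t. t \<in> {a..b} \<Longrightarrow> L-lipschitz_on UNIV (F t)"
    and cont: "\<And>x. continuous_on {a..b} (\<lambda>t. F t x)"
  shows "\<exists>u. u a = x0 \<and> (\<forall>t\<in>{a..b}. (u has_vector_derivative F t (u t)) (at t within {a..b}))"
proof -
  have L0: "L \<ge> 0" using lip[of a] ab lipschitz_on_nonneg by auto
  have cF: "continuous_on {a..b} (\<lambda>t. F t (x t))" if x: "continuous_on {a..b} x" for x
    unfolding continuous_on_def
  proof
    fix t assume t: "t \<in> {a..b}"
    have "((\<lambda>s. F s (x s) - F s (x t)) \<longlongrightarrow> 0) (at t within {a..b})"
    proof (rule Lim_null_comparison)
      show "\<forall>\<^sub>F s in at t within {a..b}. norm (F s (x s) - F s (x t)) \<le> L * norm (x s - x t)"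
        unfolding eventually_at_filter
        by (rule always_eventually) (use lip in \<open>auto simp: lipschitz_on_def dist_norm\<close>)
      have "(x \<longlongrightarrow> x t) (at t within {a..b})" using x t by (auto simp: continuous_on_def)
      then show "((\<lambda>s. L * norm (x s - x t)) \<longlongrightarrow> 0) (at t within {a..b})"
        by (auto intro!: tendsto_eq_intros simp: tendsto_norm_zero LIM_zero)
    qed
    moreover have "((\<lambda>s. F s (x t)) \<longlongrightarrow> F t (x t)) (at t within {a..b})"
      using cont t by (auto simp: continuous_on_def)
    ultimately show "((\<lambda>s. F s (x s)) \<longlongrightarrow> F t (x t)) (at t within {a..b})"
      using tendsto_add by fastforce
  qed
  txt \<open>The exponential weight turns Picard's operator into a contraction on the whole interval.\<close>
  define l where "l = 2 * L + 1"
  have l: "l > 0" "L / l \<le> 1/2" using L0 by (auto simp: l_def field_simps)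
  define G where "G v t = exp (- l * (t - a)) *\<^sub>R
      (x0 + integral {a..t} (\<lambda>s. F s (exp (l * (s - a)) *\<^sub>R apply_bcontfun v s)))"
    for v :: "real \<Rightarrow>\<^sub>C 'a" and t
  have cI: "continuous_on {a..b} (\<lambda>s. F s (exp (l * (s - a)) *\<^sub>R apply_bcontfun v s))"
    for v :: "real \<Rightarrow>\<^sub>C 'a"
    by (intro cF continuous_intros) auto
  have cG: "continuous_on (cbox a b) (G v)" for v
    unfolding G_def
    by (auto intro!: continuous_intros indefinite_integral_continuous_1 integrable_continuous_real cI)
  \<comment> \<open>The fixed point lives among bounded continuous functions on all of
    \<open>real\<close>, so \<open>G v\<close> is extended by constants outside
    \<open>{a..b}\<close>; distances are then determined by clamped times.\<close>
  have "\<exists>g :: real \<Rightarrow>\<^sub>C 'a. (\<forall>t\<in>{a..b}. g t = G v t) \<and> (\<forall>t. g t = G v (clamp a b t))" for v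
    using continuous_on_cbox_bcontfunE[OF cG[of v]] by (metis cbox_interval)
  then obtain T :: "(real \<Rightarrow>\<^sub>C 'a) \<Rightarrow> (real \<Rightarrow>\<^sub>C 'a)" where
    T: "\<And>v t. t \<in> {a..b} \<Longrightarrow> T v t = G v t" "\<And>v t. T v t = G v (clamp a b t)"
    by metis
  have "dist (T v) (T v') \<le> 1/2 * dist v v'" for v v'
  proof (rule dist_bound)
    fix t'
    define t where "t = clamp a b t'"
    have "t \<in> cbox a b" unfolding t_def using ab by (intro clamp_in_interval) auto
    then have t: "t \<in> {a..b}" by simp
    have sub: "{a..t} \<subseteq> {a..b}" using t by auto
    let ?h = "\<lambda>v s. F s (exp (l * (s - a)) *\<^sub>R apply_bcontfun v s)"
    have int: "?h v integrable_on {a..t}" for v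
      using continuous_on_subset[OF cI sub] by (rule integrable_continuous_real)
    have "((\<lambda>s. L * exp (l * (s - a)) * dist v v') has_integral
       (L / l * exp (l * (t - a)) * dist v v' - L / l * exp (l * (a - a)) * dist v v')) {a..t}"
      using t l by (intro fundamental_theorem_of_calculus)
       (auto simp: has_real_derivative_iff_has_vector_derivative[symmetric] intro!: derivative_eq_intros)
    note hi = has_integral_integrable[OF this] integral_unique[OF this]
    have "norm (integral {a..t} (\<lambda>s. ?h v s - ?h v' s)) \<le>
        integral {a..t} (\<lambda>s. L * exp (l * (s - a)) * dist v v')"
    proof (rule integral_norm_bound_integral)
      fix s assume s: "s \<in> {a..t}"
      have "norm (?h v s - ?h v' s) \<le> L * norm (exp (l * (s - a)) *\<^sub>R v s - exp (l * (s - a)) *\<^sub>R v' s)"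
        using lip[of s] s sub unfolding lipschitz_on_def dist_norm by blast
      also have "\<dots> = L * (exp (l * (s - a)) * dist (v s) (v' s))"
        by (simp add: dist_norm flip: scaleR_diff_right)
      also have "\<dots> \<le> L * (exp (l * (s - a)) * dist v v')"
        using L0 by (intro mult_left_mono dist_bounded) auto
      finally show "norm (?h v s - ?h v' s) \<le> L * exp (l * (s - a)) * dist v v'" by simp
    qed (use int hi in \<open>auto intro: integrable_diff\<close>)
    also have "\<dots> \<le> L / l * exp (l * (t - a)) * dist v v'" using hi L0 l by simp
    finally have *: "norm (integral {a..t} (?h v) - integral {a..t} (?h v')) \<le> L / l * exp (l * (t - a)) * dist v v'"
      using int by (simp add: integral_diff)
    have "dist (T v t') (T v' t') = exp (- l * (t - a)) * norm (integral {a..t} (?h v) - integral {a..t} (?h v'))"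
      unfolding T(2) t_def[symmetric] G_def dist_norm
      by (simp flip: scaleR_diff_right)
    also have "\<dots> \<le> exp (- l * (t - a)) * (L / l * exp (l * (t - a)) * dist v v')"
      by (rule mult_left_mono[OF *]) simp
    also have "\<dots> = L / l * dist v v'" by (simp add: exp_minus)
    also have "\<dots> \<le> 1/2 * dist v v'" using l by (intro mult_right_mono) auto
    finally show "dist (T v t') (T v' t') \<le> 1/2 * dist v v'" .
  qed
  then obtain v where v: "T v = v" using banach_fix_type[of "1/2" T] by auto
  define u where "u t = exp (l * (t - a)) *\<^sub>R v t" for t
  have ueq: "u t = x0 + integral {a..t} (\<lambda>s. F s (u s))" if "t \<in> {a..b}" for t
  proof -
    have "v t = G v t" using T(1)[OF that, of v] v by simp
    then show ?thesis unfolding u_def G_def by (simp add: exp_minus)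
  qed
  show ?thesis
  proof (intro exI conjI ballI)
    show "u a = x0" using ueq[of a] ab by simp
    fix t assume t: "t \<in> {a..b}"
    have "((\<lambda>t. x0 + integral {a..t} (\<lambda>s. F s (u s))) has_vector_derivative F t (u t)) (at t within {a..b})"
      using integral_has_vector_derivative[OF cI[of v] t] by (auto simp: u_def intro!: derivative_eq_intros)
    then show "(u has_vector_derivative F t (u t)) (at t within {a..b})"
      by (rule has_vector_derivative_transform[OF t, rotated]) (simp add: ueq)
  qed
qed

section \<open>Consequences of the KPP assumptions\<close>

lemma lattice_solution_subset:
  assumes "lattice_solution f I u" "J \<subseteq> I"
  shows "lattice_solution f J u"
  using assms unfolding lattice_solution_def
  by (meson DERIV_subset continuous_on_subset subsetD)

lemma lattice_solution_deriv:
  assumes "lattice_solution f I u" "t \<in> I"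
  shows "((\<lambda>t. u t i) has_real_derivative
    (u t (i + 1) - 2 * u t i + u t (i - 1) + u t i * f t (u t i))) (at t within I)"
  using assms unfolding lattice_solution_def by blast

lemma lattice_solution_continuous: "lattice_solution f I u \<Longrightarrow> continuous_on I u"
  unfolding lattice_solution_def by blast

lemma continuous_linf_bounded:
  fixes u :: "real \<Rightarrow> linf"
  assumes "continuous_on {a..b} u"
  obtains B where "B > 0" "\<And>t i. t \<in> {a..b} \<Longrightarrow> \<bar>u t i\<bar> \<le> B"
proof -
  have "compact (u ` {a..b})"
    using assms by (intro compact_continuous_image) auto
  then obtain B where B: "B > 0" "\<And>t. t \<in> {a..b} \<Longrightarrow> norm (u t) \<le> B"
    using compact_imp_bounded bounded_pos by (metis imageI)
  moreover have "\<bar>u t i\<bar> \<le> norm (u t)" for t i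
    using norm_bounded[of "u t" i] by simp
  ultimately show ?thesis using that order_trans by meson
qed

lemma lattice_solution_const:
  assumes "\<And>t. t \<in> I \<Longrightarrow> (x has_real_derivative x t * f t (x t)) (at t within I)"
  shows "lattice_solution f I (\<lambda>t. const_bcontfun (x t))"
proof -
  have "continuous_on I x" by (rule DERIV_continuous_on) (rule assms)
  moreover have "dist (const_bcontfun y :: linf) (const_bcontfun z) \<le> dist y z" for y z :: real
    by (rule dist_bound) simp
  then have "1-lipschitz_on UNIV (const_bcontfun :: real \<Rightarrow> linf)" by (simp add: lipschitz_on_def)
  then have "continuous_on UNIV (const_bcontfun :: real \<Rightarrow> linf)" by (rule lipschitz_on_continuous_on)
  ultimately have "continuous_on I (\<lambda>t. const_bcontfun (x t) :: linf)"
    using continuous_on_compose2[of UNIV const_bcontfun I x] by simp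
  then show ?thesis using assms by (simp add: lattice_solution_def)
qed

locale kpp =
  fixes f :: "real \<Rightarrow> real \<Rightarrow> real"
  assumes a: "KPP_a f" and b: "KPP_b f" and c: "KPP_c f"
begin

section \<open>Regularity of the nonlinearity\<close>

lemma continuous_in_time: "continuous_on A (\<lambda>t. f t u)"
proof -
  have "isCont (\<lambda>t. f t u) t0" for t0
  proof -
    obtain d \<alpha> C where d: "d > 0" "0 < \<alpha>"
      and H: "\<And>t t'. t \<in> ball t0 d \<Longrightarrow> t' \<in> ball t0 d \<Longrightarrow> \<bar>f t u - f t' u\<bar> \<le> C * \<bar>t - t'\<bar> powr \<alpha>"
      using a unfolding KPP_a_def locally_hoelder_def by metis
    have "((\<lambda>t. f t u - f t0 u) \<longlongrightarrow> 0) (at t0)"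
    proof (rule Lim_null_comparison)
      show "\<forall>\<^sub>F t in at t0. norm (f t u - f t0 u) \<le> C * \<bar>t - t0\<bar> powr \<alpha>"
        using eventually_at_ball[OF d(1), of t0 UNIV]
        by eventually_elim (use H d(1) in auto)
      have "((\<lambda>t. C * \<bar>t - t0\<bar> powr \<alpha>) \<longlongrightarrow> C * 0 powr \<alpha>) (at t0)"
        using d(2) by (intro tendsto_intros tendsto_powr' tendsto_rabs_zero) (auto intro: LIM_zero)
      then show "((\<lambda>t. C * \<bar>t - t0\<bar> powr \<alpha>) \<longlongrightarrow> 0) (at t0)" using d by simp
    qed
    then show ?thesis by (simp add: isCont_def LIM_zero_iff)
  qed
  then show ?thesis by (simp add: continuous_at_imp_continuous_on)
qed

lemma lipschitz_ex:
  obtains L where "L \<ge> 0" "\<And>t x y. t \<in> {p..q} \<Longrightarrow> \<bar>f t x - f t y\<bar> \<le> L * \<bar>x - y\<bar>"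
proof -
  obtain L where "\<And>t. t \<in> {p..q} \<Longrightarrow> L-lipschitz_on UNIV (f t)"
    using a unfolding KPP_a_def by metis
  then have L: "\<bar>f t x - f t y\<bar> \<le> L * \<bar>x - y\<bar>" if "t \<in> {p..q}" for t x y
    using that unfolding lipschitz_on_def by (auto simp: dist_real_def)
  show ?thesis
  proof (rule that[of "max 0 L"])
    fix t x y assume "t \<in> {p..q}"
    from L[OF this, of x y] show "\<bar>f t x - f t y\<bar> \<le> max 0 L * \<bar>x - y\<bar>"
      by (smt (verit, best) mult_right_mono abs_ge_zero)
  qed simp
qed

text \<open>Separate continuity becomes joint continuity because the Lipschitz constant in
  \<open>u\<close> is uniform on compact time intervals.\<close>

lemma continuous_joint: "continuous_on A (\<lambda>(t, x). f t x)"
proof -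
  have "isCont (\<lambda>(t, x). f t x) (t0, x0)" for t0 x0
  proof -
    obtain L where L: "L \<ge> 0" "\<And>t x y. t \<in> {t0-1..t0+1} \<Longrightarrow> \<bar>f t x - f t y\<bar> \<le> L * \<bar>x - y\<bar>"
      by (rule lipschitz_ex[where p = "t0 - 1" and q = "t0 + 1"]) blast
    have lim_fst: "(fst \<longlongrightarrow> t0) (at (t0, x0))"
      using continuous_on_fst[OF continuous_on_id, of "UNIV :: (real \<times> real) set"]
      by (simp add: continuous_on_def)
    have "((\<lambda>p. f (fst p) (snd p) - f (fst p) x0) \<longlongrightarrow> 0) (at (t0, x0))"
    proof (rule Lim_null_comparison)
      show "\<forall>\<^sub>F p in at (t0, x0). norm (f (fst p) (snd p) - f (fst p) x0) \<le> L * \<bar>snd p - x0\<bar>"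
      proof -
        have "\<forall>\<^sub>F p in at (t0, x0). dist (fst p) t0 < 1"
          by (rule tendstoD[OF lim_fst]) simp
        then show ?thesis
          by eventually_elim (use L in \<open>auto simp: dist_real_def abs_le_iff abs_less_iff\<close>)
      qed
      show "((\<lambda>p. L * \<bar>snd p - x0\<bar>) \<longlongrightarrow> 0) (at (t0, x0))"
        by (auto intro!: tendsto_eq_intros)
    qed
    moreover have "((\<lambda>p. f (fst p) x0) \<longlongrightarrow> f t0 x0) (at (t0, x0))"
      using isCont_tendsto_compose[OF _ lim_fst, of "\<lambda>t. f t x0"] continuous_in_time[of UNIV x0]
      by (simp add: continuous_on_eq_continuous_at)
    ultimately show ?thesis unfolding isCont_def case_prod_beta using tendsto_add by fastforce
  qed
  then have "isCont (\<lambda>(t, x). f t x) p" for p by (cases p) auto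
  then show ?thesis by (simp add: continuous_at_imp_continuous_on)
qed

lemma continuous_comp:
  assumes "continuous_on A g" "continuous_on A h"
  shows "continuous_on A (\<lambda>t. f (g t) (h t))"
  using continuous_on_compose2[OF continuous_joint[of UNIV] continuous_on_Pair[OF assms]]
  by auto

section \<open>Monotonicity in \<open>u\<close> and gaps that are uniform in time\<close>

lemma partial_u_deriv:
  assumes "u \<ge> 0"
  shows "(f t has_real_derivative partial_u f t u) (at u within {0..})"
proof -
  have "f t differentiable (at u within {0..})"
    using a assms unfolding KPP_a_def differentiable_on_def by simp
  then show ?thesis unfolding partial_u_def
    by (simp add: vector_derivative_works has_real_derivative_iff_has_vector_derivative)
qed

lemma partial_u_neg: "u \<ge> 0 \<Longrightarrow> \<exists>c>0. \<forall>t. partial_u f t u \<le> - c"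
  using b unfolding KPP_b_def by blast

lemma mean_value:
  assumes "0 \<le> x" "x < y"
  obtains z where "x < z" "z < y" "f t y - f t x = (y - x) * partial_u f t z"
proof -
  have "\<exists>z\<in>{x<..<y}. f t y - f t x = (\<lambda>z h. partial_u f t z * h) z (y - x)"
  proof (rule mvt_simple)
    fix z assume z: "x \<le> z" "z \<le> y"
    then have "(f t has_real_derivative partial_u f t z) (at z within {x..y})"
      using partial_u_deriv[of z t] assms by (auto elim!: DERIV_subset)
    then show "(f t has_derivative (\<lambda>h. partial_u f t z * h)) (at z within {x..y})"
      by (simp add: has_field_derivative_def)
  qed (use assms in auto)
  then obtain z where "z \<in> {x<..<y}" "f t y - f t x = partial_u f t z * (y - x)" by blast
  then show ?thesis using that[of z] by (simp add: mult.commute)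
qed

lemma antimono:
  assumes "0 \<le> x" "x \<le> y"
  shows "f t y \<le> f t x"
proof (cases "x = y")
  case False
  then have "x < y" using assms by simp
  then obtain z where z: "x < z" "z < y" "f t y - f t x = (y - x) * partial_u f t z"
    by (rule mean_value[OF assms(1)])
  obtain c where "c > 0" "partial_u f t z \<le> - c" using partial_u_neg[of z] assms z(1) by auto
  then have "(y - x) * partial_u f t z \<le> 0" using \<open>x < y\<close> by (intro mult_nonneg_nonpos) auto
  then show ?thesis using z(3) by linarith
qed simp

lemma uniform_gap:
  assumes "0 \<le> p" "p < q"
  shows "\<exists>\<eta>>0. \<forall>t. f t q \<le> f t p - \<eta>"
proof -
  txt \<open>The bounds \<open>partial_u f t w \<le> - c\<close> depend on \<open>w\<close>, but by Baire's theorem one of the closed sets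
    where \<open>- 1 / (n + 1)\<close> works for all \<open>t\<close> contains an interval.\<close>
  define W where "W n = {w \<in> {p..q}. \<exists>t. partial_u f t w > - 1 / (real n + 1)}" for n :: nat
  have openW: "openin (top_of_set {p..q}) (W n)" for n
  proof -
    have "openin (top_of_set {p..q}) {w \<in> {p..q}. partial_u f t w > - 1 / (real n + 1)}" for t
    proof -
      have "continuous_on {p..q} (partial_u f t)"
        by (rule continuous_on_subset[of "{0..}"]) (use a assms in \<open>auto simp: KPP_a_def\<close>)
      from continuous_openin_preimage_gen[OF this, of "{- 1 / (real n + 1)<..}"]
      have "openin (top_of_set {p..q}) ({p..q} \<inter> partial_u f t -` {- 1 / (real n + 1)<..})" by simp
      also have "{p..q} \<inter> partial_u f t -` {- 1 / (real n + 1)<..} =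
          {w \<in> {p..q}. partial_u f t w > - 1 / (real n + 1)}" by auto
      finally show ?thesis .
    qed
    moreover have "W n = (\<Union>t. {w \<in> {p..q}. partial_u f t w > - 1 / (real n + 1)})"
      by (auto simp: W_def)
    ultimately show ?thesis by (metis (no_types, lifting) openin_Union imageE)
  qed
  have empty: "\<Inter>(range W) = {}"
  proof (rule ccontr)
    assume "\<Inter>(range W) \<noteq> {}"
    then obtain w where w: "\<And>n. w \<in> W n" by auto
    then have "w \<in> {p..q}" using w[of 0] by (simp add: W_def)
    then obtain c where c: "c > 0" "\<And>t. partial_u f t w \<le> - c"
      using partial_u_neg[of w] assms by auto
    obtain n where n: "inverse (real (Suc n)) < c" using reals_Archimedean[OF c(1)] by blast
    obtain t where "partial_u f t w > - 1 / (real n + 1)" using w[of n] by (auto simp: W_def)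
    then show False using n c(2)[of t] by (simp add: inverse_eq_divide add.commute)
  qed
  have "\<exists>n. \<not> {p..q} \<subseteq> closure (W n)"
  proof (rule ccontr)
    assume "\<not> ?thesis"
    then have "{p..q} \<subseteq> closure (\<Inter>(range W))"
      by (intro Baire) (use openW in auto)
    then show False using assms empty by auto
  qed
  then obtain n w where w: "w \<in> {p..q}" "w \<notin> closure (W n)" by blast
  then obtain e where e: "e > 0" "\<And>y. y \<in> W n \<Longrightarrow> \<not> dist y w < e"
    unfolding closure_approachable by blast
  \<comment> \<open>Clipping to \<open>{p..q}\<close> leaves a nondegenerate interval even if
    \<open>w\<close> is an endpoint. The slope bound gives the decrease on \<open>{p'..q'}\<close>,
    and monotonicity extends it to \<open>{p..q}\<close>.\<close>
  define p' where "p' = max p (w - e / 2)"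
  define q' where "q' = min q (w + e / 2)"
  have pq: "p \<le> p'" "p' < q'" "q' \<le> q" using assms w e(1) by (auto simp: p'_def q'_def)
  have small: "partial_u f t z \<le> - 1 / (real n + 1)" if "p' < z" "z < q'" for t z
  proof -
    have "dist z w < e" "z \<in> {p..q}" using that e(1) by (auto simp: p'_def q'_def dist_real_def)
    then have "z \<notin> W n" using e(2) by blast
    then show ?thesis using \<open>z \<in> {p..q}\<close> by (auto simp: W_def not_less)
  qed
  show ?thesis
  proof (intro exI conjI allI)
    show "(q' - p') / (real n + 1) > 0" using pq by simp
    fix t
    obtain z where z: "p' < z" "z < q'" "f t q' - f t p' = (q' - p') * partial_u f t z"
      using mean_value[of p' q' t] pq assms by auto
    have "(q' - p') * partial_u f t z \<le> (q' - p') * (- 1 / (real n + 1))"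
      using small[OF z(1,2), of t] pq by (intro mult_left_mono) auto
    moreover have "f t q \<le> f t q'" "f t p' \<le> f t p" using antimono pq assms by auto
    ultimately show "f t q \<le> f t p - (q' - p') / (real n + 1)" using z(3) by simp
  qed
qed

text \<open>On a grid of mesh \<open>d / 2\<close> a full cell always fits between \<open>x\<close>
  and \<open>x + d\<close>: it starts at the first grid point not below \<open>x\<close>. For
  \<open>x \<le> \<beta>\<close> only finitely many cells occur, so the minimum of their gaps is
  positive.\<close>

lemma uniform_gap_compact:
  assumes "d > 0"
  shows "\<exists>\<eta>>0. \<forall>t x y. 0 \<le> x \<longrightarrow> x \<le> \<beta> \<longrightarrow> x + d \<le> y \<longrightarrow> f t y \<le> f t x - \<eta>"
proof -
  define h where "h = d / 2"
  have h: "h > 0" using assms by (simp add: h_def)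
  have "\<forall>k::nat. \<exists>\<eta>>0. \<forall>t. f t ((real k + 1) * h) \<le> f t (real k * h) - \<eta>"
    using h by (intro allI uniform_gap) auto
  then obtain \<eta> where \<eta>: "\<And>k. \<eta> k > 0" "\<And>k t. f t ((real k + 1) * h) \<le> f t (real k * h) - \<eta> (k::nat)"
    by metis
  define N where "N = nat \<lceil>\<beta> / h\<rceil>"
  define \<eta>0 where "\<eta>0 = Min (\<eta> ` {..N})"
  show ?thesis
  proof (intro exI conjI allI impI)
    show "\<eta>0 > 0" unfolding \<eta>0_def using \<eta>(1) by (subst Min_gr_iff) auto
    fix t x y assume x: "0 \<le> x" "x \<le> \<beta>" and y: "x + d \<le> y"
    define k where "k = nat \<lceil>x / h\<rceil>"
    have k: "x / h \<le> real k" "real k < x / h + 1" using x h by (auto simp: k_def) linarith+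
    have "k \<le> N" unfolding k_def N_def using x h by (intro nat_mono ceiling_mono divide_right_mono) auto
    then have "\<eta>0 \<le> \<eta> k" unfolding \<eta>0_def by (intro Min_le) auto
    moreover have "x \<le> real k * h" using k(1) h by (simp add: field_simps)
    then have "f t (real k * h) \<le> f t x" using x by (intro antimono) auto
    moreover have "(real k + 1) * h \<le> y"
    proof -
      have "real k * h < x + h" using k(2) h by (simp add: field_simps)
      then show ?thesis using y by (simp add: h_def field_simps)
    qed
    then have "f t y \<le> f t ((real k + 1) * h)" using h by (intro antimono) auto
    ultimately show "f t y \<le> f t x - \<eta>0" using \<eta>(2)[of t k] by linarith
  qed
qed

text \<open>One fixed bound for \<open>f t 0\<close>, chosen once so that later lemmas share it. By
  monotonicity it bounds the growth rate \<open>f t u\<close> from above at every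
  \<open>u \<ge> 0\<close>.\<close>

definition growth_bound :: real where
  "growth_bound = (SOME K. K > 0 \<and> (\<forall>t. \<bar>f t 0\<bar> \<le> K))"

lemma growth_bound: "growth_bound > 0" "\<bar>f t 0\<bar> \<le> growth_bound"
proof -
  have "bounded (range (\<lambda>t. f t 0))" using b by (simp add: KPP_b_def)
  then have "\<exists>K. K > 0 \<and> (\<forall>t. \<bar>f t 0\<bar> \<le> K)" unfolding bounded_pos by auto
  then have "growth_bound > 0 \<and> (\<forall>t. \<bar>f t 0\<bar> \<le> growth_bound)"
    unfolding growth_bound_def by (rule someI_ex)
  then show "growth_bound > 0" "\<bar>f t 0\<bar> \<le> growth_bound" by auto
qed

lemma f_le_growth_bound: "u \<ge> 0 \<Longrightarrow> f t u \<le> growth_bound"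
  using antimono[of 0 u t] growth_bound(2)[of t] by simp

section \<open>Local bounds and uniqueness\<close>

lemma f_bounded:
  obtains B where "B > 0" "\<And>t x. t \<in> {p..q} \<Longrightarrow> \<bar>x\<bar> \<le> R \<Longrightarrow> \<bar>f t x\<bar> \<le> B"
proof -
  have "compact ((\<lambda>(t, x). f t x) ` ({p..q} \<times> {-R..R}))"
    by (intro compact_continuous_image continuous_joint compact_Times compact_Icc)
  then obtain B where B: "B > 0" "\<And>z. z \<in> (\<lambda>(t, x). f t x) ` ({p..q} \<times> {-R..R}) \<Longrightarrow> \<bar>z\<bar> \<le> B"
    using compact_imp_bounded bounded_pos by (metis real_norm_def)
  show ?thesis
    by (rule that[OF B(1)], rule B(2)) (auto simp: abs_le_iff image_iff intro!: bexI)
qed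

lemma reaction_lipschitz:
  obtains L where "L \<ge> 0"
    "\<And>t x y. t \<in> {p..q} \<Longrightarrow> \<bar>x\<bar> \<le> R \<Longrightarrow> \<bar>y\<bar> \<le> R \<Longrightarrow> \<bar>x * f t x - y * f t y\<bar> \<le> L * \<bar>x - y\<bar>"
proof -
  obtain B where B: "B > 0" "\<And>t x. t \<in> {p..q} \<Longrightarrow> \<bar>x\<bar> \<le> R \<Longrightarrow> \<bar>f t x\<bar> \<le> B" by (rule f_bounded) blast
  obtain L where L: "L \<ge> 0" "\<And>t x y. t \<in> {p..q} \<Longrightarrow> \<bar>f t x - f t y\<bar> \<le> L * \<bar>x - y\<bar>"
    by (rule lipschitz_ex) blast
  show ?thesis
  proof (rule that[of "B + \<bar>R\<bar> * L"])
    fix t x y assume *: "t \<in> {p..q}" "\<bar>x\<bar> \<le> R" "\<bar>y\<bar> \<le> R"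
    have "x * f t x - y * f t y = (x - y) * f t x + y * (f t x - f t y)" by (simp add: algebra_simps)
    also have "\<bar>\<dots>\<bar> \<le> \<bar>x - y\<bar> * \<bar>f t x\<bar> + \<bar>y\<bar> * \<bar>f t x - f t y\<bar>"
      by (metis abs_mult abs_triangle_ineq)
    also have "\<dots> \<le> \<bar>x - y\<bar> * B + \<bar>R\<bar> * (L * \<bar>x - y\<bar>)"
      using * by (intro add_mono mult_mono B L) auto
    finally show "\<bar>x * f t x - y * f t y\<bar> \<le> (B + \<bar>R\<bar> * L) * \<bar>x - y\<bar>" by (simp add: algebra_simps)
  qed (use B L in auto)
qed

text \<open>This version admits solutions of any sign, as uniqueness behind
  \<open>solution_from\<close> demands. The constant in the maximum principle may depend on the
  interval and on the two solutions, so a local Lipschitz constant serves.\<close>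

lemma lattice_solution_comparison:
  assumes u: "lattice_solution f {p..q} u" and v: "lattice_solution f {p..q} v"
    and init: "\<And>i. u p i \<le> v p i" and t: "t \<in> {p..q}"
  shows "u t i \<le> v t i"
proof -
  obtain B1 where B1: "B1 > 0" "\<And>t i. t \<in> {p..q} \<Longrightarrow> \<bar>u t i\<bar> \<le> B1"
    by (rule continuous_linf_bounded[OF lattice_solution_continuous[OF u]]) blast
  obtain B2 where B2: "B2 > 0" "\<And>t i. t \<in> {p..q} \<Longrightarrow> \<bar>v t i\<bar> \<le> B2"
    by (rule continuous_linf_bounded[OF lattice_solution_continuous[OF v]]) blast
  obtain L where L: "\<And>t x y. t \<in> {p..q} \<Longrightarrow> \<bar>x\<bar> \<le> B1 + B2 \<Longrightarrow> \<bar>y\<bar> \<le> B1 + B2 \<Longrightarrow>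
      \<bar>x * f t x - y * f t y\<bar> \<le> L * \<bar>x - y\<bar>"
    by (rule reaction_lipschitz[of p q "B1 + B2"]) blast
  have "u t i - v t i \<le> 0"
  proof (rule lattice_maximum_principle[where w = "\<lambda>t i. u t i - v t i"])
    fix t i assume t: "t \<in> {p..q}"
    show "u t i - v t i \<le> B1 + B2" using B1(2)[OF t, of i] B2(2)[OF t, of i] by linarith
    show "((\<lambda>t. u t i - v t i) has_real_derivative
        (u t (i + 1) - 2 * u t i + u t (i - 1) + u t i * f t (u t i)) -
        (v t (i + 1) - 2 * v t i + v t (i - 1) + v t i * f t (v t i))) (at t within {p..q})"
      by (intro DERIV_diff lattice_solution_deriv[OF u t] lattice_solution_deriv[OF v t])
    assume "u t i - v t i > 0"
    moreover have "\<bar>u t i * f t (u t i) - v t i * f t (v t i)\<bar> \<le> L * \<bar>u t i - v t i\<bar>"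
      using B1(1) B2(1) B1(2)[OF t, of i] B2(2)[OF t, of i] by (intro L t) auto
    ultimately show "(u t (i + 1) - 2 * u t i + u t (i - 1) + u t i * f t (u t i)) -
        (v t (i + 1) - 2 * v t i + v t (i - 1) + v t i * f t (v t i))
      \<le> (u t (i + 1) - v t (i + 1)) - 2 * (u t i - v t i) + (u t (i - 1) - v t (i - 1)) + L * (u t i - v t i)"
      by (simp add: abs_le_iff)
  qed (use init t in auto)
  then show ?thesis by simp
qed

lemma lattice_solution_unique:
  assumes "lattice_solution f {p..q} u" "lattice_solution f {p..q} v" "u p = v p" "t \<in> {p..q}"
  shows "u t = v t"
proof (rule bcontfun_eqI, rule order_antisym)
  show "u t i \<le> v t i" for i
    by (rule lattice_solution_comparison[OF assms(1,2) _ assms(4)]) (simp add: assms(3))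
  show "v t i \<le> u t i" for i
    by (rule lattice_solution_comparison[OF assms(2,1) _ assms(4)]) (simp add: assms(3))
qed

text \<open>Uniqueness resolves the description operator; \<open>solution_from\<close> looks at
  \<open>{s..t}\<close> only, hence the restriction of \<open>u\<close>.\<close>

lemma solution_from_eq:
  assumes u: "lattice_solution f {s..r} u" and t: "t \<in> {s..r}"
  shows "solution_from f s (u s) t = u t"
  unfolding solution_from_def
proof (rule the_equality)
  have u': "lattice_solution f {s..t} u"
    using lattice_solution_subset[OF u] t by auto
  then show "\<exists>v. lattice_solution f {s..t} v \<and> v s = u s \<and> v t = u t" by blast
  fix x assume "\<exists>v. lattice_solution f {s..t} v \<and> v s = u s \<and> v t = x"
  then obtain v where v: "lattice_solution f {s..t} v" "v s = u s" "v t = x" by blast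
  show "x = u t" using lattice_solution_unique[OF v(1) u' v(2), of t] v(3) t by simp
qed

end

section \<open>Existence and comparison of nonnegative solutions\<close>

definition shift :: "linf \<Rightarrow> linf" where
  "shift x = Bcontfun (\<lambda>i. x (i + 1))"

text \<open>
  The library proves completeness of \<open>'a \<Rightarrow>\<^sub>C 'b\<close> only over a metric domain, so the integers
  are given their usual metric, which induces the discrete topology they already carry.
\<close>

instantiation int :: metric_space
begin

definition dist_int :: "int \<Rightarrow> int \<Rightarrow> real" where
  "dist_int m n = \<bar>real_of_int m - real_of_int n\<bar>"

definition uniformity_int :: "(int \<times> int) filter" where
  "uniformity_int = (INF e\<in>{0<..}. principal {(x, y). dist x y < e})"

instance
proof
  fix U :: "int set" and x y z :: int
  have "\<forall>\<^sub>F (x', y) in uniformity. x' = x \<longrightarrow> y \<in> U" if "x \<in> U" for x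
    unfolding uniformity_int_def
  proof (rule eventually_INF1[of 1])
    have "x = y" if "dist x y < 1" for y using that unfolding dist_int_def by linarith
    then show "\<forall>\<^sub>F (x', y) in principal {(x, y). dist x y < 1}. x' = x \<longrightarrow> y \<in> U"
      using that by (auto simp: eventually_principal)
  qed simp
  then show "open U \<longleftrightarrow> (\<forall>x\<in>U. \<forall>\<^sub>F (x', y) in uniformity. x' = x \<longrightarrow> y \<in> U)"
    by (simp add: open_discrete)
  show "dist x y = 0 \<longleftrightarrow> x = y" by (simp add: dist_int_def)
  show "dist x y \<le> dist x z + dist y z" by (simp add: dist_int_def)
qed (rule uniformity_int_def)

end

instance bcontfun :: (metric_space, banach) banach ..

lemma Bcontfun_int_apply:
  fixes g :: "int \<Rightarrow> real"
  assumes "\<And>i. \<bar>g i\<bar> \<le> B"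
  shows "apply_bcontfun (Bcontfun g) i = g i"
proof -
  have "g \<in> bcontfun" by (rule bcontfun_normI[where b = B]) (simp_all add: assms)
  then show ?thesis by (simp add: Bcontfun_inverse)
qed

lemma abs_linf_le_norm: "\<bar>apply_bcontfun (x :: linf) i\<bar> \<le> norm x"
  using norm_bounded[of x i] by simp

lemma shift_apply: "shift x i = x (i + 1)"
  unfolding shift_def by (rule Bcontfun_int_apply[where B = "norm x"]) (rule abs_linf_le_norm)

lemma lattice_solution_shift:
  assumes "lattice_solution f I u"
  shows "lattice_solution f I (\<lambda>t. shift (u t))"
proof -
  have "dist (shift x) (shift y) \<le> dist x y" for x y
    by (rule dist_bound) (simp add: shift_apply dist_bounded)
  then have "1-lipschitz_on UNIV shift" by (simp add: lipschitz_on_def)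
  then have "continuous_on UNIV shift" by (rule lipschitz_on_continuous_on)
  then have "continuous_on I (\<lambda>t. shift (u t))"
    using continuous_on_compose2[of UNIV shift I u] lattice_solution_continuous[OF assms] by simp
  moreover have "((\<lambda>t. shift (u t) i) has_real_derivative
      (shift (u t) (i + 1) - 2 * shift (u t) i + shift (u t) (i - 1)
        + shift (u t) i * f t (shift (u t) i))) (at t within I)" if "t \<in> I" for t i
    using lattice_solution_deriv[OF assms that, of "i + 1"] by (simp add: shift_apply)
  ultimately show ?thesis by (simp add: lattice_solution_def)
qed

lemma bounded_linear_apply_linf: "bounded_linear (\<lambda>x :: linf. apply_bcontfun x i)"
  by (rule bounded_linear_intro[where K = 1]) (simp_all add: abs_linf_le_norm)

section \<open>Comparison with a time-independent constant, and existence\<close>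

context kpp
begin

text \<open>As \<open>f t\<close> decreases, replacing \<open>f t x\<close> by \<open>f t y\<close>
  in the subtracted term can only enlarge the difference. The remaining factor \<open>f t y\<close>
  is bounded above uniformly in time.\<close>

lemma reaction_one_sided:
  assumes "0 \<le> x" "x \<le> y"
  shows "y * f t y - x * f t x \<le> growth_bound * (y - x)"
proof -
  have "x * f t y \<le> x * f t x" using antimono assms by (intro mult_left_mono) auto
  then have "y * f t y - x * f t x \<le> (y - x) * f t y" by (simp add: algebra_simps)
  also have "\<dots> \<le> (y - x) * growth_bound"
    using f_le_growth_bound assms by (intro mult_left_mono) auto
  finally show ?thesis by (simp add: mult.commute)
qed

text \<open>The maximum principle looks only at points with \<open>v t i > u t i\<close>; there
  nonnegativity of \<open>u\<close> puts both values in the range of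
  \<open>reaction_one_sided\<close>. An upper bound on \<open>v\<close> bounds the difference, so
  \<open>u\<close> may contain a quadratic weight.\<close>

lemma sub_super_comparison:
  fixes u v u' v' :: "real \<Rightarrow> int \<Rightarrow> real"
  assumes nonneg: "\<And>t i. t \<in> {p..q} \<Longrightarrow> 0 \<le> u t i"
    and bound: "\<And>t i. t \<in> {p..q} \<Longrightarrow> v t i \<le> B"
    and dv: "\<And>t i. t \<in> {p..q} \<Longrightarrow> ((\<lambda>t. v t i) has_real_derivative v' t i) (at t within {p..q})"
    and du: "\<And>t i. t \<in> {p..q} \<Longrightarrow> ((\<lambda>t. u t i) has_real_derivative u' t i) (at t within {p..q})"
    and sub: "\<And>t i. t \<in> {p..q} \<Longrightarrow> v' t i \<le> v t (i + 1) - 2 * v t i + v t (i - 1) + v t i * f t (v t i)"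
    and super: "\<And>t i. t \<in> {p..q} \<Longrightarrow> u t (i + 1) - 2 * u t i + u t (i - 1) + u t i * f t (u t i) \<le> u' t i"
    and init: "\<And>i. v p i \<le> u p i"
    and t: "t \<in> {p..q}"
  shows "v t i \<le> u t i"
proof -
  have "v t i - u t i \<le> 0"
  proof (rule lattice_maximum_principle[where w = "\<lambda>t i. v t i - u t i" and w' = "\<lambda>t i. v' t i - u' t i"])
    fix t i assume t: "t \<in> {p..q}"
    show "v t i - u t i \<le> B" using nonneg[OF t, of i] bound[OF t, of i] by linarith
    show "((\<lambda>t. v t i - u t i) has_real_derivative v' t i - u' t i) (at t within {p..q})"
      by (intro DERIV_diff dv du t)
    assume "v t i - u t i > 0"
    then have "v t i * f t (v t i) - u t i * f t (u t i) \<le> growth_bound * (v t i - u t i)"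
      using nonneg[OF t] by (intro reaction_one_sided) auto
    then show "v' t i - u' t i \<le> (v t (i + 1) - u t (i + 1)) - 2 * (v t i - u t i)
        + (v t (i - 1) - u t (i - 1)) + growth_bound * (v t i - u t i)"
      using sub[OF t, of i] super[OF t, of i] by (simp add: algebra_simps)
  qed (use init t in auto)
  then show ?thesis by simp
qed

lemma solution_exists:
  fixes u0 :: linf
  assumes sr: "s \<le> r" and u0: "\<And>i. 0 \<le> u0 i" "\<And>i. u0 i \<le> R" and R: "\<And>t. f t R \<le> 0"
  obtains u where "lattice_solution f {s..r} u" "u s = u0"
    "\<And>t i. t \<in> {s..r} \<Longrightarrow> 0 \<le> u t i" "\<And>t i. t \<in> {s..r} \<Longrightarrow> u t i \<le> R"
proof -
  txt \<open>Truncating the argument of \<open>f\<close> to \<open>{0..R}\<close> makes the right-hand side globally Lipschitz; the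
    solution of the truncated equation never leaves this interval.\<close>
  define cl where "cl x = max 0 (min R x)" for x :: real
  have R0: "0 \<le> R" using u0 order_trans by blast
  have cl: "\<bar>cl x - cl y\<bar> \<le> \<bar>x - y\<bar>" "cl x \<in> {0..R}" "\<bar>cl x\<bar> \<le> R" for x y
    using R0 by (auto simp: cl_def)
  define g where "g t x = cl x * f t (cl x)" for t x
  obtain L where L: "L \<ge> 0" "\<And>t x y. t \<in> {s..r} \<Longrightarrow> \<bar>x\<bar> \<le> R \<Longrightarrow> \<bar>y\<bar> \<le> R \<Longrightarrow>
      \<bar>x * f t x - y * f t y\<bar> \<le> L * \<bar>x - y\<bar>"
    by (rule reaction_lipschitz[of s r R]) blast
  have gL: "\<bar>g t x - g t y\<bar> \<le> L * \<bar>x - y\<bar>" if "t \<in> {s..r}" for t x y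
  proof -
    have "\<bar>g t x - g t y\<bar> \<le> L * \<bar>cl x - cl y\<bar>" unfolding g_def by (intro L that cl)
    also have "\<dots> \<le> L * \<bar>x - y\<bar>" by (intro mult_left_mono cl L)
    finally show ?thesis .
  qed
  have gB: "\<exists>B. \<forall>x. \<bar>g t x\<bar> \<le> B" for t
  proof -
    obtain B where B: "\<And>t' x. t' \<in> {t..t} \<Longrightarrow> \<bar>x\<bar> \<le> R \<Longrightarrow> \<bar>f t' x\<bar> \<le> B"
      by (rule f_bounded[of t t R]) blast
    have "\<bar>g t x\<bar> \<le> R * B" for x
      unfolding g_def abs_mult using cl B[of t "cl x"] R0 by (intro mult_mono) auto
    then show ?thesis by blast
  qed
  define h where "h t x i = x (i + 1) - 2 * x i + x (i - 1) + g t (x i)" for t and x :: linf and i :: int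
  define F :: "real \<Rightarrow> linf \<Rightarrow> linf" where "F t x = Bcontfun (h t x)" for t x
  have F: "F t x i = h t x i" for t x i
  proof -
    obtain B where "\<And>x. \<bar>g t x\<bar> \<le> B" using gB by blast
    then have "\<bar>h t x i\<bar> \<le> 4 * norm x + B" for i
      unfolding h_def using abs_linf_le_norm[of x i] abs_linf_le_norm[of x "i+1"]
        abs_linf_le_norm[of x "i-1"] by (smt (verit, best))
    then show ?thesis unfolding F_def by (rule Bcontfun_int_apply)
  qed
  have lip: "(4 + L)-lipschitz_on UNIV (F t)" if t: "t \<in> {s..r}" for t
  proof (rule lipschitz_onI)
    fix x y :: linf
    show "dist (F t x) (F t y) \<le> (4 + L) * dist x y"
    proof (rule dist_bound)
      fix i
      have d: "\<bar>x j - y j\<bar> \<le> dist x y" for j using dist_bounded[of x j y] by (simp add: dist_real_def)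
      have "\<bar>g t (x i) - g t (y i)\<bar> \<le> L * dist x y"
        using gL[OF t, of "x i" "y i"] mult_left_mono[OF d L(1)] order_trans by blast
      then have "\<bar>h t x i - h t y i\<bar> \<le> 4 * dist x y + L * dist x y"
        unfolding h_def using d[of i] d[of "i+1"] d[of "i-1"] by linarith
      then show "dist (F t x i) (F t y i) \<le> (4 + L) * dist x y"
        by (simp add: F dist_real_def algebra_simps)
    qed
  qed (use L in simp)
  \<comment> \<open>Continuity in the supremum norm has to be uniform over all sites. Truncation
    confines the arguments to \<open>{0..R}\<close>, where uniform continuity on a compact rectangle
    provides this.\<close>
  have cont: "continuous_on {s..r} (\<lambda>t. F t x)" for x
    unfolding continuous_on_iff
  proof (intro ballI allI impI)
    fix t e :: real assume t: "t \<in> {s..r}" and e: "e > 0"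
    have "uniformly_continuous_on ({s..r} \<times> {0..R}) (\<lambda>(t, y). y * f t y)"
      unfolding case_prod_beta
      by (intro compact_uniformly_continuous compact_Times compact_Icc continuous_intros continuous_comp)
    then obtain d where d: "d > 0" "\<And>z z'. z \<in> {s..r} \<times> {0..R} \<Longrightarrow> z' \<in> {s..r} \<times> {0..R} \<Longrightarrow>
       dist z' z < d \<Longrightarrow> dist (case z' of (t, y) \<Rightarrow> y * f t y) (case z of (t, y) \<Rightarrow> y * f t y) < e / 2"
      unfolding uniformly_continuous_on_def using half_gt_zero[OF e] by blast
    show "\<exists>d>0. \<forall>t'\<in>{s..r}. dist t' t < d \<longrightarrow> dist (F t' x) (F t x) < e"
    proof (intro exI conjI ballI impI)
      fix t' assume t': "t' \<in> {s..r}" "dist t' t < d"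
      have "dist (F t' x) (F t x) \<le> e / 2"
      proof (rule dist_bound)
        fix i
        have "dist (g t' (x i)) (g t (x i)) < e / 2"
          unfolding g_def
          using d(2)[of "(t, cl (x i))" "(t', cl (x i))"] t t' cl(2)[of "x i"] by (simp add: dist_Pair_Pair)
        then show "dist (F t' x i) (F t x i) \<le> e / 2" by (simp add: F h_def dist_real_def)
      qed
      then show "dist (F t' x) (F t x) < e" using e by simp
    qed (rule d)
  qed
  obtain u where us: "u s = u0"
    and du: "\<And>t. t \<in> {s..r} \<Longrightarrow> (u has_vector_derivative F t (u t)) (at t within {s..r})"
    using picard_lindeloef_lipschitz[OF sr lip cont] by metis
  have cu: "continuous_on {s..r} u"
    using du by (meson continuous_on_eq_continuous_within has_vector_derivative_continuous)
  have dui: "((\<lambda>t. u t i) has_real_derivative h t (u t) i) (at t within {s..r})" if "t \<in> {s..r}" for t i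
    unfolding has_real_derivative_iff_has_vector_derivative
    using bounded_linear.has_vector_derivative[OF bounded_linear_apply_linf du[OF that], of i]
    by (simp add: F)
  obtain B where B: "B > 0" "\<And>t i. t \<in> {s..r} \<Longrightarrow> \<bar>u t i\<bar> \<le> B"
    by (rule continuous_linf_bounded[OF cu]) blast
  \<comment> \<open>The truncated reaction vanishes below \<open>0\<close> and is at most
    \<open>0\<close> above \<open>R\<close>, since \<open>f t R \<le> 0\<close>. Both one-sided
    bounds thus follow from the maximum principle with \<open>K = 0\<close>.\<close>
  have lower: "0 \<le> u t i" if t: "t \<in> {s..r}" for t i
  proof -
    have "- u t i \<le> 0"
    proof (rule lattice_maximum_principle[where w = "\<lambda>t i. - u t i" and K = 0 and a = s and b = r
            and B = B and w' = "\<lambda>t i. - h t (u t) i"])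
      fix t i assume t: "t \<in> {s..r}"
      show "- u t i \<le> B" using B(2)[OF t, of i] by linarith
      show "((\<lambda>t. - u t i) has_real_derivative - h t (u t) i) (at t within {s..r})"
        by (intro DERIV_minus dui t)
      assume "- u t i > 0"
      then have "g t (u t i) = 0" by (simp add: g_def cl_def)
      then show "- h t (u t) i \<le> - u t (i + 1) - 2 * - u t i + - u t (i - 1) + 0 * - u t i"
        by (simp add: h_def)
    qed (use us u0 t in auto)
    then show ?thesis by simp
  qed
  have upper: "u t i \<le> R" if t: "t \<in> {s..r}" for t i
  proof -
    have "u t i - R \<le> 0"
    proof (rule lattice_maximum_principle[where w = "\<lambda>t i. u t i - R" and K = 0 and a = s and b = r
            and B = B and w' = "\<lambda>t i. h t (u t) i"])
      fix t i assume t: "t \<in> {s..r}"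
      show "u t i - R \<le> B" using B(2)[OF t, of i] R0 by linarith
      show "((\<lambda>t. u t i - R) has_real_derivative h t (u t) i) (at t within {s..r})"
        using DERIV_diff[OF dui[OF t] DERIV_const] by simp
      assume "u t i - R > 0"
      then have "cl (u t i) = R" using R0 by (simp add: cl_def)
      then have "g t (u t i) \<le> 0" unfolding g_def using R R0 by (simp add: mult_nonneg_nonpos)
      then show "h t (u t) i \<le> u t (i + 1) - R - 2 * (u t i - R) + (u t (i - 1) - R) + 0 * (u t i - R)"
        by (simp add: h_def)
    qed (use us u0 t in auto)
    then show ?thesis by simp
  qed
  have "g t (u t i) = u t i * f t (u t i)" if "t \<in> {s..r}" for t i
    using lower[OF that, of i] upper[OF that, of i] by (simp add: g_def cl_def)
  then have "lattice_solution f {s..r} u"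
    using cu dui by (simp add: lattice_solution_def h_def)
  then show ?thesis using that us lower upper by blast
qed

text \<open>The equation is invariant under translation, so the shifted solution has the same
  initial value and uniqueness identifies the two.\<close>

lemma solution_constant_data:
  assumes u: "lattice_solution f {s..r} u" and init: "\<And>i. u s i = R" and t: "t \<in> {s..r}"
  shows "u t i = u t 0"
proof -
  have "shift (u t) = u t"
    by (rule lattice_solution_unique[OF lattice_solution_shift[OF u] u _ t])
      (rule bcontfun_eqI, simp add: shift_apply init)
  then have step: "u t (i + 1) = u t i" for i by (metis shift_apply)
  show ?thesis
  proof (induction i rule: int_induct[where k = 0])
    case (step1 i) then show ?case using step by simp
  next
    case (step2 i) then show ?case using step[of "i - 1"] by simp
  qed simp
qed

text \<open>The scalar equation is solved by site \<open>0\<close> of the lattice solution with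
  constant data, whose diffusion term vanishes.\<close>

lemma scalar_solution_exists:
  assumes sr: "s \<le> r" and R: "R \<ge> 0" "\<And>t. f t R \<le> 0"
  obtains x where "x s = R"
    "\<And>t. t \<in> {s..r} \<Longrightarrow> (x has_real_derivative x t * f t (x t)) (at t within {s..r})"
    "\<And>t. t \<in> {s..r} \<Longrightarrow> 0 \<le> x t" "\<And>t. t \<in> {s..r} \<Longrightarrow> x t \<le> R"
proof -
  obtain u where u: "lattice_solution f {s..r} u" "u s = const_bcontfun R"
    "\<And>t i. t \<in> {s..r} \<Longrightarrow> 0 \<le> u t i" "\<And>t i. t \<in> {s..r} \<Longrightarrow> u t i \<le> R"
    by (rule solution_exists[OF sr, of "const_bcontfun R" R]) (use R in auto)
  show ?thesis
  proof (rule that[of "\<lambda>t. u t 0"])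
    fix t assume t: "t \<in> {s..r}"
    have "u t i = u t 0" for i by (rule solution_constant_data[OF u(1) _ t]) (simp add: u)
    then have "u t 1 = u t 0" "u t (- 1) = u t 0" by blast+
    then show "((\<lambda>t. u t 0) has_real_derivative u t 0 * f t (u t 0)) (at t within {s..r})"
      using lattice_solution_deriv[OF u(1) t, of 0] by simp
  qed (use u in auto)
qed

end

section \<open>The entire solution\<close>

context kpp
begin

lemma carrying_capacity:
  "\<exists>R. R > 0 \<and> R \<ge> B \<and> (\<forall>t. f t R \<le> 0)"
proof -
  obtain M where M: "M > 0" "\<And>t u. u \<ge> M \<Longrightarrow> f t u < 0"
    using b unfolding KPP_b_def by blast
  show ?thesis by (rule exI[of _ "max M B"]) (use M in \<open>auto intro: less_imp_le\<close>)
qed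

text \<open>Any \<open>c0\<close> strictly between \<open>0\<close> and the limit inferior works.
  The filter depends on \<open>t - s\<close> alone, so the threshold is uniform in \<open>s\<close>;
  taking it at least \<open>1\<close> allows multiplying by the interval length.\<close>

lemma mean_growth_positive:
  obtains c0 T where "c0 > 0" "T > 0" "\<And>s t. t - s \<ge> T \<Longrightarrow> integral {s..t} (\<lambda>\<tau>. f \<tau> 0) \<ge> c0 * (t - s)"
proof -
  have "0 < Liminf (filtercomap (\<lambda>(s, t). t - s) at_top)
       (\<lambda>(s, t). ereal (1 / (t - s) * integral {s..t} (\<lambda>\<tau>. f \<tau> 0)))"
    using b unfolding KPP_b_def by blast
  then obtain c0 where c0: "0 < ereal c0" "ereal c0 < Liminf (filtercomap (\<lambda>(s, t). t - s) at_top)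
       (\<lambda>(s, t). ereal (1 / (t - s) * integral {s..t} (\<lambda>\<tau>. f \<tau> 0)))"
    using ereal_dense2 by blast
  have "\<forall>\<^sub>F (s, t) in filtercomap (\<lambda>(s, t). t - s) at_top.
      c0 < 1 / (t - s) * integral {s..t} (\<lambda>\<tau>. f \<tau> 0)"
    using less_LiminfD[OF c0(2)] by (rule eventually_mono) auto
  then obtain T where T: "\<And>s t. t - s \<ge> T \<Longrightarrow> c0 < 1 / (t - s) * integral {s..t} (\<lambda>\<tau>. f \<tau> 0)"
    unfolding eventually_filtercomap_at_top_linorder by fastforce
  show ?thesis
  proof (rule that[of c0 "max 1 T"])
    fix s t assume st: "t - s \<ge> max 1 T"
    then have "c0 < 1 / (t - s) * integral {s..t} (\<lambda>\<tau>. f \<tau> 0)" using T by simp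
    then show "integral {s..t} (\<lambda>\<tau>. f \<tau> 0) \<ge> c0 * (t - s)" using st by (simp add: field_simps)
  qed (use c0 in auto)
qed

lemma antiderivative_ex:
  fixes g :: "real \<Rightarrow> real"
  assumes "continuous_on UNIV g"
  shows "\<exists>G. \<forall>x. (G has_real_derivative g x) (at x)"
  using einterval_antiderivative[of "-\<infinity>" "\<infinity>" g] assms
  by (auto simp: continuous_on_eq_continuous_at has_real_derivative_iff_has_vector_derivative)

text \<open>
  With \<open>P' t = f t 0\<close> and \<open>Q\<close> the moving average of \<open>P\<close> over a window of length \<open>T\<close>,
  the function \<open>P - Q\<close> is bounded and \<open>Q' \<ge> c0\<close>, so that small multiples of \<open>exp (P - Q)\<close> are
  subsolutions.
\<close>

lemma bounded_subsolution_exists: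
  assumes R: "R > 0"
  obtains \<psi> \<psi>' \<delta> where "\<delta> > 0" "\<And>t. (\<psi> has_real_derivative \<psi>' t) (at t)"
    "\<And>t. \<psi>' t \<le> \<psi> t * f t (\<psi> t)" "\<And>t. \<delta> \<le> \<psi> t" "\<And>t. \<psi> t \<le> R"
proof -
  obtain c0 T where c0: "c0 > 0" "T > 0" and
    avg: "\<And>s t. t - s \<ge> T \<Longrightarrow> integral {s..t} (\<lambda>\<tau>. f \<tau> 0) \<ge> c0 * (t - s)"
    by (rule mean_growth_positive) blast
  obtain M where M: "M > 0" "\<And>t u. u \<ge> 0 \<Longrightarrow> f t 0 - M * u \<le> f t u"
  proof -
    obtain m M where "0 < m" "m < M" "\<forall>t. \<forall>u\<ge>0. f t 0 - M * u \<le> f t u"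
      using c unfolding KPP_c_def by blast
    then show thesis using that[of M] by force
  qed
  obtain P where P: "\<And>t. (P has_real_derivative f t 0) (at t)"
    using antiderivative_ex[OF continuous_in_time[of UNIV 0]] by blast
  have "continuous_on UNIV P"
    using P by (meson DERIV_isCont continuous_at_imp_continuous_on)
  then obtain P2 where P2: "\<And>t. (P2 has_real_derivative P t) (at t)"
    using antiderivative_ex by blast
  define Q where "Q t = (P2 (t + T) - P2 t) / T" for t
  define Q' where "Q' t = (P (t + T) - P t) / T" for t
  have dQ: "(Q has_real_derivative Q' t) (at t)" for t
  proof -
    have "((\<lambda>t. P2 (t + T)) has_real_derivative P (t + T)) (at t)"
      using P2[of "t + T"] by (simp add: DERIV_shift)
    then show ?thesis unfolding Q_def[abs_def] Q'_def
      by (intro DERIV_cdivide DERIV_diff P2)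
  qed
  have Q'_ge: "Q' t \<ge> c0" for t
  proof -
    have "((\<lambda>\<tau>. f \<tau> 0) has_integral (P (t + T) - P t)) {t..t + T}"
      using c0 P by (intro fundamental_theorem_of_calculus)
        (auto simp: has_real_derivative_iff_has_vector_derivative[symmetric] intro: DERIV_subset)
    then have "P (t + T) - P t \<ge> c0 * T" using avg[where s = t and t = "t + T"] by (simp add: integral_unique)
    then show ?thesis using c0 by (simp add: Q'_def field_simps)
  qed
  define A where "A = growth_bound * T"
  \<comment> \<open>The average \<open>Q t\<close> equals \<open>P z\<close> for some
    \<open>z\<close> in the window, at distance less than \<open>T\<close> from \<open>t\<close>,
    and the slope of \<open>P\<close> is at most \<open>growth_bound\<close> in absolute
    value.\<close>
  have PQ: "\<bar>P t - Q t\<bar> \<le> A" for t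
  proof -
    obtain z where z: "t < z" "z < t + T" "P2 (t + T) - P2 t = (t + T - t) * P z"
      using MVT2[of t "t + T" P2 P] P2 c0 by auto
    then have "Q t = P z" using c0 by (simp add: Q_def)
    moreover obtain y where y: "t < y" "y < z" "P z - P t = (z - t) * f y 0"
      using MVT2[of t z P "\<lambda>t. f t 0"] P z by auto
    have "\<bar>P z - P t\<bar> \<le> T * growth_bound" unfolding y(3) abs_mult
      using z y growth_bound by (intro mult_mono) auto
    ultimately show ?thesis by (simp add: A_def mult.commute abs_minus_commute)
  qed
  \<comment> \<open>The factor \<open>exp (- A)\<close> cancels the largest value of
    \<open>exp (P t - Q t)\<close>. The cap \<open>c0 / M\<close> gives
    \<open>M * \<psi> t \<le> c0 \<le> Q' t\<close>, which makes \<open>\<psi>\<close> a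
    subsolution; the cap \<open>R\<close> places it below the starting values of the pullback
    sequence.\<close>
  define \<delta>0 where "\<delta>0 = min (c0 / M) R * exp (- A)"
  have \<delta>0: "\<delta>0 > 0" using c0 M R by (simp add: \<delta>0_def)
  define \<psi> where "\<psi> t = \<delta>0 * exp (P t - Q t)" for t
  define \<psi>' where "\<psi>' t = \<psi> t * (f t 0 - Q' t)" for t
  have upper: "\<psi> t \<le> min (c0 / M) R" for t
  proof -
    have "\<psi> t \<le> \<delta>0 * exp A" unfolding \<psi>_def using PQ[of t] \<delta>0 by (intro mult_left_mono) auto
    also have "\<delta>0 * exp A = min (c0 / M) R" by (simp add: \<delta>0_def mult.assoc flip: exp_add)
    finally show ?thesis .
  qed
  show ?thesis
  proof
    show "\<delta>0 * exp (- A) > 0" using \<delta>0 by simp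
    show "(\<psi> has_real_derivative \<psi>' t) (at t)" for t
      unfolding \<psi>_def[abs_def] \<psi>'_def
      by (auto intro!: derivative_eq_intros P dQ simp: algebra_simps)
    show "\<delta>0 * exp (- A) \<le> \<psi> t" for t
      unfolding \<psi>_def using PQ[of t] \<delta>0 by (intro mult_left_mono) auto
    show "\<psi> t \<le> R" for t using upper[of t] by simp
    show "\<psi>' t \<le> \<psi> t * f t (\<psi> t)" for t
    proof -
      have pos: "\<psi> t \<ge> 0" using \<delta>0 by (simp add: \<psi>_def)
      have "M * \<psi> t \<le> c0" using upper[of t] M by (simp add: field_simps)
      then have "f t 0 - Q' t \<le> f t (\<psi> t)" using Q'_ge[of t] M(2)[OF pos, of t] by linarith
      then show ?thesis unfolding \<psi>'_def using pos by (intro mult_left_mono)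
    qed
  qed
qed

text \<open>The entire solution is the pullback limit of the solutions that start from a supersolution
  \<open>R\<close> at the times \<open>-n\<close>; these decrease in \<open>n\<close> and stay above the bounded subsolution.\<close>

lemma entire_scalar_solution_exists:
  obtains V \<alpha> \<beta> where "0 < \<alpha>" "\<And>t. (V has_real_derivative V t * f t (V t)) (at t)"
    "\<And>t. \<alpha> \<le> V t" "\<And>t. V t \<le> \<beta>"
proof -
  obtain R where R: "R > 0" "\<And>t. f t R \<le> 0" using carrying_capacity by blast
  obtain \<psi> \<psi>' \<delta> where \<delta>: "\<delta> > 0" and \<psi>: "\<And>t. (\<psi> has_real_derivative \<psi>' t) (at t)"
    "\<And>t. \<psi>' t \<le> \<psi> t * f t (\<psi> t)" "\<And>t. \<delta> \<le> \<psi> t" "\<And>t. \<psi> t \<le> R"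
    by (rule bounded_subsolution_exists[OF R(1)]) blast
  have "\<exists>x. x (- real n) = R \<and> (\<forall>t\<in>{- real n..real n}. 0 \<le> x t \<and> x t \<le> R \<and>
      (x has_real_derivative x t * f t (x t)) (at t within {- real n..real n}))" for n
    by (rule scalar_solution_exists[of "- real n" "real n" R]) (use R in auto)
  then obtain x where x0: "\<And>n. x n (- real n) = R"
    and x: "\<And>n t. t \<in> {- real n..real n} \<Longrightarrow> 0 \<le> x n t"
      "\<And>n t. t \<in> {- real n..real n} \<Longrightarrow> x n t \<le> R"
      "\<And>n t. t \<in> {- real n..real n} \<Longrightarrow>
         (x n has_real_derivative x n t * f t (x n t)) (at t within {- real n..real n})"
    by metis
  have lower: "\<psi> t \<le> x n t" if t: "t \<in> {- real n..real n}" for n t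
    by (rule sub_super_comparison[where v = "\<lambda>t i. \<psi> t" and u = "\<lambda>t i. x n t" and v' = "\<lambda>t i. \<psi>' t"
          and u' = "\<lambda>t i. x n t * f t (x n t)" and B = R and p = "- real n" and q = "real n"])
      (use x \<psi> t x0 has_field_derivative_at_within[OF \<psi>(1)] in auto)
  \<comment> \<open>The solution with the larger index starts earlier and is at most
    \<open>R\<close> at time \<open>- real n\<close>, exactly where the other one starts with value
    \<open>R\<close>.\<close>
  have mono: "x m t \<le> x n t" if nm: "n \<le> m" and t: "t \<in> {- real n..real n}" for n m t
  proof -
    have sub: "{- real n..real n} \<subseteq> {- real m..real m}" using nm by auto
    have "- real n \<in> {- real m..real m}" using nm by auto
    then have init: "x m (- real n) \<le> x n (- real n)" using x(2)[of "- real n" m] by (simp add: x0)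
    show ?thesis
      by (rule sub_super_comparison[where v = "\<lambda>t i. x m t" and u = "\<lambda>t i. x n t"
          and v' = "\<lambda>t i. x m t * f t (x m t)"
          and u' = "\<lambda>t i. x n t * f t (x n t)" and B = R and p = "- real n" and q = "real n"])
        (use x(1)[of _ n] x(2)[OF subsetD[OF sub]] DERIV_subset[OF x(3)[OF subsetD[OF sub]] sub]
          x(3)[of _ n] init t in auto)
  qed
  have "\<exists>L. (\<lambda>n. x n t) \<longlonglongrightarrow> L \<and> L \<le> R \<and> \<delta> \<le> L" for t
  proof -
    obtain N :: nat where N: "\<bar>t\<bar> \<le> real N" using real_arch_simple by blast
    have tN: "t \<in> {- real (N + k)..real (N + k)}" for k using N by auto
    have bd: "\<delta> \<le> x (N + k) t" "x (N + k) t \<le> R" for k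
      using lower[OF tN[of k]] \<psi>(3)[of t] x(2)[OF tN[of k]] by auto
    have "decseq (\<lambda>k. x (N + k) t)" using tN by (intro decseq_SucI mono) auto
    then obtain L where L: "(\<lambda>k. x (N + k) t) \<longlonglongrightarrow> L" by (rule decseq_convergent) (use bd in auto)
    then have "\<delta> \<le> L" "L \<le> R" using bd by (auto intro: LIMSEQ_le_const LIMSEQ_le_const2)
    moreover have "(\<lambda>n. x n t) \<longlonglongrightarrow> L" using L LIMSEQ_offset[of "\<lambda>n. x n t" N] by (simp add: add.commute)
    ultimately show ?thesis by blast
  qed
  then obtain V where V: "\<And>t. (\<lambda>n. x n t) \<longlonglongrightarrow> V t" "\<And>t. V t \<le> R" "\<And>t. \<delta> \<le> V t" by metis
  \<comment> \<open>Differentiability passes to the limit through the integral equation, by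
    dominated convergence. That equation first makes \<open>V\<close>, hence \<open>G\<close>,
    continuous, and then the integral can be differentiated.\<close>
  have "(V has_real_derivative V t * f t (V t)) (at t)" for t
  proof -
    obtain N :: nat where N: "\<bar>t\<bar> < real N" using reals_Archimedean2 by blast
    let ?I = "{- real N..real N}"
    obtain B where B: "B > 0" "\<And>t x. t \<in> ?I \<Longrightarrow> \<bar>x\<bar> \<le> R \<Longrightarrow> \<bar>f t x\<bar> \<le> B"
      by (rule f_bounded[of "- real N" "real N" R]) blast
    define G where "G s = V s * f s (V s)" for s
    have int: "G integrable_on {- real N..r}" "V r = V (- real N) + integral {- real N..r} G"
      if r: "r \<in> ?I" for r
    proof -
      let ?J = "{- real N..r}"
      define g where "g k s = x (N + k) s * f s (x (N + k) s)" for k s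
      have sub: "?J \<subseteq> {- real (N + k)..real (N + k)}" for k using r by auto
      have hi: "(g k has_integral x (N + k) r - x (N + k) (- real N)) ?J" for k
        unfolding g_def
        by (intro fundamental_theorem_of_calculus)
          (use r x(3) sub[of k] in \<open>auto simp: has_real_derivative_iff_has_vector_derivative[symmetric]
             intro!: DERIV_subset[OF x(3) sub]\<close>)
      have lim: "(\<lambda>k. x (N + k) s) \<longlonglongrightarrow> V s" for s
        using LIMSEQ_ignore_initial_segment[OF V(1)[of s], of N] by (simp add: add.commute)
      have gb: "norm (g k s) \<le> R * B" if "s \<in> ?J" for k s
      proof -
        have "s \<in> {- real (N + k)..real (N + k)}" "s \<in> ?I" using that sub[of k] r by auto
        then show ?thesis unfolding g_def real_norm_def abs_mult
          using x(1,2)[of s "N + k"] B(2)[of s "x (N + k) s"] R by (intro mult_mono) auto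
      qed
      have gl: "(\<lambda>k. g k s) \<longlonglongrightarrow> G s" if "s \<in> ?J" for s
      proof -
        have "isCont (f s) (V s)"
          using continuous_comp[of UNIV "\<lambda>_. s" "\<lambda>y. y"] by (simp add: continuous_on_eq_continuous_at)
        then show ?thesis unfolding g_def G_def
          using lim by (intro tendsto_mult isCont_tendsto_compose[of "V s" "f s"]) auto
      qed
      note dc = dominated_convergence[of g ?J "\<lambda>_. R * B" G, OF _ _ gb gl]
      have gi: "g k integrable_on ?J" for k using hi by blast
      show "G integrable_on ?J" by (rule dc(1)) (use gi in auto)
      have "(\<lambda>k. integral ?J (g k)) \<longlonglongrightarrow> integral ?J G" by (rule dc(2)) (use gi in auto)
      then have "(\<lambda>k. x (N + k) r - x (N + k) (- real N)) \<longlonglongrightarrow> integral ?J G"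
        unfolding integral_unique[OF hi] .
      moreover have "(\<lambda>k. x (N + k) r - x (N + k) (- real N)) \<longlonglongrightarrow> V r - V (- real N)"
        by (intro tendsto_diff lim)
      ultimately have "integral ?J G = V r - V (- real N)" by (rule LIMSEQ_unique)
      then show "V r = V (- real N) + integral ?J G" by simp
    qed
    have "continuous_on ?I (\<lambda>r. V (- real N) + integral {- real N..r} G)"
      by (intro continuous_intros indefinite_integral_continuous_1 int) simp
    then have "continuous_on ?I V"
      by (rule continuous_on_eq) (rule int(2)[symmetric])
    then have "continuous_on ?I G" unfolding G_def by (intro continuous_intros continuous_comp)
    then have "((\<lambda>r. integral {- real N..r} G) has_real_derivative G t) (at t within ?I)"
      using N by (intro integral_has_real_derivative) auto
    then have "((\<lambda>r. V (- real N) + integral {- real N..r} G) has_real_derivative G t) (at t within ?I)"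
      by (auto intro!: derivative_eq_intros)
    then have "(V has_real_derivative G t) (at t within ?I)"
    proof (rule has_field_derivative_transform_within[OF _ zero_less_one])
      show "t \<in> ?I" using N by auto
    qed (rule int(2)[symmetric])
    then show ?thesis using N by (simp add: at_within_Icc_at G_def)
  qed
  then show ?thesis using that[OF \<delta>, of V R] V by blast
qed

end

section \<open>Convergence to the entire solution\<close>

context kpp
begin

text \<open>\<open>solution_from\<close> selects a solution separately for each final time;
  uniqueness shows that all these values belong to one solution on \<open>{s..r}\<close>.\<close>

lemma solution_from_lattice_solution:
  fixes u0 :: linf
  assumes u0: "\<And>i. 0 \<le> u0 i" and sr: "s \<le> r"
  shows "lattice_solution f {s..r} (solution_from f s u0)" (is ?sol)
    and "solution_from f s u0 s = u0" (is ?init)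
    and "\<And>t i. t \<in> {s..r} \<Longrightarrow> 0 \<le> solution_from f s u0 t i" (is "\<And>t i. _ \<Longrightarrow> ?pos t i")
proof -
  obtain R where R: "norm u0 \<le> R" "\<And>t. f t R \<le> 0" using carrying_capacity by blast
  have "u0 i \<le> R" for i using abs_linf_le_norm[of u0 i] R(1) by linarith
  then obtain u where u: "lattice_solution f {s..r} u" "u s = u0" "\<And>t i. t \<in> {s..r} \<Longrightarrow> 0 \<le> u t i"
    using solution_exists[OF sr, of u0 R] u0 R(2) by metis
  have eq: "solution_from f s u0 t = u t" if "t \<in> {s..r}" for t
    using solution_from_eq[OF u(1) that] u(2) by simp
  show ?init using eq[of s] u(2) sr by simp
  show "?pos t i" if "t \<in> {s..r}" for t i using u(3)[OF that] eq[OF that] by simp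
  show ?sol unfolding lattice_solution_def
  proof (intro conjI ballI allI)
    show "continuous_on {s..r} (solution_from f s u0)"
      by (rule continuous_on_eq[OF lattice_solution_continuous[OF u(1)]]) (simp add: eq)
    fix t i assume t: "t \<in> {s..r}"
    show "((\<lambda>t. solution_from f s u0 t i) has_real_derivative
        (solution_from f s u0 t (i + 1) - 2 * solution_from f s u0 t i + solution_from f s u0 t (i - 1)
          + solution_from f s u0 t i * f t (solution_from f s u0 t i))) (at t within {s..r})"
      unfolding eq[OF t]
      by (rule has_field_derivative_transform_within[OF lattice_solution_deriv[OF u(1) t] zero_less_one t])
        (simp add: eq)
  qed
qed

text \<open>With \<open>K = growth_bound\<close>, the reciprocal satisfies
  \<open>(1 / x)' \<ge> m - K / x\<close>, so \<open>h t = exp (K * t) * (1 / x t - m / K)\<close>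
  is nondecreasing. It exceeds \<open>- m / K * exp (K * t)\<close>, which tends to \<open>0\<close>
  in the past; hence \<open>h\<close> is never negative and \<open>x t \<le> K / m\<close>.\<close>

lemma entire_scalar_solution_bounded:
  assumes x: "\<And>t. (x has_real_derivative x t * f t (x t)) (at t)" and pos: "\<And>t. x t > 0"
  obtains \<beta> where "\<And>t. x t \<le> \<beta>"
proof -
  let ?K = growth_bound
  obtain m where m: "m > 0" "\<And>t u. u \<ge> 0 \<Longrightarrow> f t u \<le> f t 0 - m * u"
    using c unfolding KPP_c_def by blast
  define h where "h t = exp (?K * t) / x t - m / ?K * exp (?K * t)" for t
  define h' where "h' t = exp (?K * t) * ((?K - f t (x t)) / x t - m)" for t
  have K: "?K > 0" by (rule growth_bound)
  have dh: "(h has_real_derivative h' t) (at t)" for t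
    unfolding h_def[abs_def] h'_def using pos[of t] K
    by (auto intro!: derivative_eq_intros x simp: field_simps)
  have h'0: "h' t \<ge> 0" for t
  proof -
    have "m * x t \<le> ?K - f t (x t)"
      using m(2)[of "x t" t] growth_bound(2)[of t] pos[of t] by linarith
    then have "m \<le> (?K - f t (x t)) / x t" using pos[of t] by (simp add: pos_le_divide_eq)
    then show ?thesis unfolding h'_def by simp
  qed
  have "x t \<le> ?K / m" for t
  proof (rule ccontr)
    assume "\<not> x t \<le> ?K / m"
    then have "?K < m * x t" using m by (simp add: field_simps)
    then have neg: "h t < 0" using pos[of t] K by (simp add: h_def field_simps)
    \<comment> \<open>Chosen so that \<open>exp (?K * t1) \<le> y\<close> forces
      \<open>h t1 \<ge> h t / 2\<close>, which exceeds the negative number \<open>h t\<close>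
      although \<open>t1 \<le> t\<close>.\<close>
    define y where "y = - h t * ?K / (2 * m)"
    have y: "y > 0" unfolding y_def using neg K m by (intro divide_pos_pos mult_pos_pos) auto
    define t1 where "t1 = min t (ln y / ?K)"
    have "?K * t1 \<le> ln y" using K by (simp add: t1_def min_def field_simps)
    then have "exp (?K * t1) \<le> y" using y by (simp add: ln_ge_iff)
    then have "m / ?K * exp (?K * t1) \<le> m / ?K * y" using m K by (intro mult_left_mono) auto
    also have "\<dots> = - h t / 2" using m K by (simp add: y_def)
    finally have "h t / 2 \<le> - (m / ?K * exp (?K * t1))" by simp
    also have "\<dots> \<le> h t1" using pos[of t1] by (simp add: h_def)
    also have "h t1 \<le> h t"
      by (rule DERIV_nonneg_imp_nondecreasing) (use dh h'0 in \<open>auto simp: t1_def\<close>)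
    finally show False using neg by simp
  qed
  then show ?thesis by (rule that)
qed

end

section \<open>Squeezing solutions onto a bounded entire solution\<close>

locale kpp_entire = kpp +
  fixes V :: "real \<Rightarrow> real" and \<alpha> \<beta> :: real
  assumes V: "\<And>t. (V has_real_derivative V t * f t (V t)) (at t)"
    and \<alpha>: "0 < \<alpha>" "\<And>t. \<alpha> \<le> V t" and \<beta>: "\<And>t. V t \<le> \<beta>"
begin

lemma \<beta>_pos: "\<beta> > 0"
  using \<alpha>(1) \<alpha>(2)[of 0] \<beta>[of 0] by linarith

lemma V_pos: "V t > 0"
  using \<alpha>(1) \<alpha>(2)[of t] by linarith

text \<open>A factor \<open>exp \<theta>\<close> or \<open>exp (- \<theta>)\<close> with
  \<open>\<theta> \<ge> \<epsilon>\<close> moves \<open>V t\<close> by at least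
  \<open>\<alpha> * (1 - exp (- \<epsilon>))\<close>; upwards this uses
  \<open>exp \<theta> - 1 \<ge> 1 - exp (- \<theta>)\<close>. The bounds on \<open>V\<close> then
  give a gap uniform in time.\<close>

lemma relative_decay_rate:
  assumes "\<epsilon> > 0"
  obtains \<eta> where "\<eta> > 0"
    "\<And>t \<theta>. \<epsilon> \<le> \<theta> \<Longrightarrow> f t (V t * exp \<theta>) \<le> f t (V t) - \<eta>"
    "\<And>t \<theta>. \<epsilon> \<le> \<theta> \<Longrightarrow> f t (V t) \<le> f t (V t * exp (- \<theta>)) - \<eta>"
proof -
  define d where "d = \<alpha> * (1 - exp (- \<epsilon>))"
  have d: "d > 0" using assms \<alpha> by (simp add: d_def)
  obtain \<eta> where \<eta>: "\<eta> > 0" "\<And>t x y. 0 \<le> x \<Longrightarrow> x \<le> \<beta> \<Longrightarrow> x + d \<le> y \<Longrightarrow> f t y \<le> f t x - \<eta>"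
    using uniform_gap_compact[OF d] by metis
  show ?thesis
  proof (rule that[OF \<eta>(1)])
    fix t \<theta> assume \<theta>: "\<epsilon> \<le> \<theta>"
    have e: "0 \<le> 1 - exp (- \<epsilon>)" "1 - exp (- \<epsilon>) \<le> 1 - exp (- \<theta>)" using \<theta> assms by auto
    have "exp (- \<theta>) + exp \<theta> \<ge> 2"
    proof -
      have "1 + (- \<theta>) \<le> exp (- \<theta>)" "1 + \<theta> \<le> exp \<theta>" by (rule exp_ge_add_one_self)+
      then show ?thesis by linarith
    qed
    then have e2: "1 - exp (- \<epsilon>) \<le> exp \<theta> - 1" using e by linarith
    have "d \<le> V t * (exp \<theta> - 1)" unfolding d_def using \<alpha> V_pos[of t] e e2
      by (intro mult_mono) (auto intro: less_imp_le)
    then show "f t (V t * exp \<theta>) \<le> f t (V t) - \<eta>"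
      using V_pos[of t] \<beta>[of t] by (intro \<eta>(2)) (auto simp: algebra_simps)
    have "d \<le> V t * (1 - exp (- \<theta>))" unfolding d_def using \<alpha> V_pos[of t] e
      by (intro mult_mono) (auto intro: less_imp_le)
    moreover have "V t * exp (- \<theta>) \<le> \<beta> * 1" using \<beta>[of t] V_pos[of t] \<theta> assms
      by (intro mult_mono) auto
    ultimately show "f t (V t) \<le> f t (V t * exp (- \<theta>)) - \<eta>"
      using V_pos[of t] by (intro \<eta>(2)) (auto simp: algebra_simps)
  qed
qed

text \<open>\<open>V t * exp (\<theta> t)\<close> with \<open>\<theta>\<close> decreasing linearly to \<open>\<epsilon>\<close> is a supersolution, because its growth
  rate exceeds the one allowed by \<open>f\<close> as long as \<open>\<theta> \<ge> \<epsilon>\<close>.\<close>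

lemma upper_estimate:
  assumes \<epsilon>: "\<epsilon> > 0" and B: "B > 0"
  obtains \<tau> where "\<tau> \<ge> 0"
    "\<And>t0 t1 u i. t0 + \<tau> \<le> t1 \<Longrightarrow> lattice_solution f {t0..t1} u \<Longrightarrow> (\<And>j. u t0 j \<le> B) \<Longrightarrow>
       u t1 i \<le> V t1 * exp \<epsilon>"
proof -
  obtain \<eta> where \<eta>: "\<eta> > 0" "\<And>t \<theta>. \<epsilon> \<le> \<theta> \<Longrightarrow> f t (V t * exp \<theta>) \<le> f t (V t) - \<eta>"
    by (rule relative_decay_rate[OF \<epsilon>]) blast
  \<comment> \<open>The logarithmic distance from the lower bound \<open>\<alpha>\<close> of
    \<open>V\<close> up to \<open>B\<close>; at rate \<open>\<eta>\<close> it is covered within time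
    \<open>\<theta>0 / \<eta>\<close>.\<close>
  define \<theta>0 where "\<theta>0 = max 0 (ln (B / \<alpha>))"
  show ?thesis
  proof (rule that[of "\<theta>0 / \<eta>"])
    show "0 \<le> \<theta>0 / \<eta>" using \<eta> by (simp add: \<theta>0_def)
    fix t0 t1 u i
    assume t01: "t0 + \<theta>0 / \<eta> \<le> t1" and u: "lattice_solution f {t0..t1} u" and init: "\<And>j. u t0 j \<le> B"
    have "\<theta>0 / \<eta> \<ge> 0" using \<eta> by (simp add: \<theta>0_def)
    then have le: "t0 \<le> t1" using t01 by linarith
    obtain B1 where B1: "\<And>t i. t \<in> {t0..t1} \<Longrightarrow> \<bar>u t i\<bar> \<le> B1"
      by (rule continuous_linf_bounded[OF lattice_solution_continuous[OF u]]) blast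
    \<comment> \<open>Measuring from the final time makes \<open>\<theta> t1 = \<epsilon>\<close>
      exact, and longer intervals only raise the initial value \<open>\<theta> t0\<close>.\<close>
    define \<theta> where "\<theta> t = \<epsilon> + \<eta> * (t1 - t)" for t
    define S where "S t = V t * exp (\<theta> t)" for t
    have "u t1 i \<le> S t1"
    proof (rule sub_super_comparison[where v = "\<lambda>t i. u t i" and u = "\<lambda>t i. S t" and B = B1
          and p = t0 and q = t1 and u' = "\<lambda>t i. S t * (f t (V t) - \<eta>)"
          and v' = "\<lambda>t i. u t (i + 1) - 2 * u t i + u t (i - 1) + u t i * f t (u t i)"])
      fix t i assume t: "t \<in> {t0..t1}"
      show S0: "0 \<le> S t" using V_pos[of t] by (simp add: S_def)
      show "u t i \<le> B1" using B1[OF t, of i] by linarith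
      show "(S has_real_derivative S t * (f t (V t) - \<eta>)) (at t within {t0..t1})"
        unfolding S_def[abs_def] \<theta>_def
        by (auto intro!: derivative_eq_intros has_field_derivative_at_within[OF V] simp: algebra_simps)
      have "\<epsilon> \<le> \<theta> t" using t \<eta> by (simp add: \<theta>_def)
      then have "S t * f t (S t) \<le> S t * (f t (V t) - \<eta>)"
        using \<eta>(2)[of "\<theta> t" t] S0 by (intro mult_left_mono) (auto simp: S_def)
      then show "S t - 2 * S t + S t + S t * f t (S t) \<le> S t * (f t (V t) - \<eta>)" by simp
    next
      fix j
      have "\<theta>0 \<le> \<eta> * (t1 - t0)" using t01 \<eta> by (simp add: field_simps)
      then have "ln (B / \<alpha>) \<le> \<theta> t0" using \<epsilon> by (simp add: \<theta>_def \<theta>0_def)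
      then have "exp (ln (B / \<alpha>)) \<le> exp (\<theta> t0)" by simp
      then have "B \<le> \<alpha> * exp (\<theta> t0)" using B \<alpha> by (simp add: field_simps)
      also have "\<dots> \<le> S t0" unfolding S_def using \<alpha> by (intro mult_right_mono) auto
      finally show "u t0 j \<le> S t0" using init[of j] by linarith
    qed (use lattice_solution_deriv[OF u] le in auto)
    then show "u t1 i \<le> V t1 * exp \<epsilon>" by (simp add: S_def \<theta>_def)
  qed
qed

text \<open>The quadratic weight compensates for sites far from \<open>i\<close>, where no lower bound is known at the
  initial time: adding a supersolution of the equation linearised from above to \<open>u\<close> gives a
  supersolution of the full equation.\<close>

lemma lower_estimate:
  assumes \<epsilon>: "\<epsilon> > 0" and \<delta>: "\<delta> > 0"
  obtains \<tau> where "\<tau> \<ge> 0"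
    "\<And>t0 t1 u i C. t0 + \<tau> \<le> t1 \<Longrightarrow> lattice_solution f {t0..t1} u \<Longrightarrow>
       (\<And>t j. t \<in> {t0..t1} \<Longrightarrow> 0 \<le> u t j) \<Longrightarrow> 0 \<le> C \<Longrightarrow>
       (\<And>j. \<delta> \<le> u t0 j + C * (1 + (real_of_int (j - i))\<^sup>2)) \<Longrightarrow>
       V t1 * exp (- \<epsilon>) \<le> u t1 i + C * exp ((growth_bound + 2) * (t1 - t0))"
proof -
  obtain \<eta> where \<eta>: "\<eta> > 0" "\<And>t \<theta>. \<epsilon> \<le> \<theta> \<Longrightarrow> f t (V t) \<le> f t (V t * exp (- \<theta>)) - \<eta>"
    by (rule relative_decay_rate[OF \<epsilon>]) blast
  \<comment> \<open>Now the logarithmic distance from the upper bound \<open>\<beta>\<close> of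
    \<open>V\<close> down to \<open>\<delta>\<close>.\<close>
  define \<theta>0 where "\<theta>0 = max 0 (ln (\<beta> / \<delta>))"
  \<comment> \<open>\<open>growth_bound\<close> absorbs the change of the reaction term caused by
    adding \<open>z\<close>; the \<open>2\<close> absorbs the discrete Laplacian of the weight,
    which equals \<open>2 \<le> 2 * w j\<close>.\<close>
  let ?k = "growth_bound + 2"
  show ?thesis
  proof (rule that[of "\<theta>0 / \<eta>"])
    show "0 \<le> \<theta>0 / \<eta>" using \<eta> by (simp add: \<theta>0_def)
    fix t0 t1 u i C
    assume t01: "t0 + \<theta>0 / \<eta> \<le> t1" and u: "lattice_solution f {t0..t1} u"
      and nonneg: "\<And>t j. t \<in> {t0..t1} \<Longrightarrow> 0 \<le> u t j" and C: "0 \<le> C"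
      and init: "\<And>j. \<delta> \<le> u t0 j + C * (1 + (real_of_int (j - i))\<^sup>2)"
    have "\<theta>0 / \<eta> \<ge> 0" using \<eta> by (simp add: \<theta>0_def)
    then have le: "t0 \<le> t1" using t01 by linarith
    define \<theta> where "\<theta> t = \<epsilon> + \<eta> * (t1 - t)" for t
    define S where "S t = V t * exp (- \<theta> t)" for t
    define w where "w j = 1 + (real_of_int (j - i))\<^sup>2" for j
    define z where "z t j = C * w j * exp (?k * (t - t0))" for t j
    have z0: "0 \<le> z t j" for t j using C by (simp add: z_def w_def)
    have "S t1 \<le> u t1 i + z t1 i"
    proof (rule sub_super_comparison[where v = "\<lambda>t i. S t" and u = "\<lambda>t i. u t i + z t i" and B = \<beta>
          and p = t0 and q = t1 and v' = "\<lambda>t i. S t * (f t (V t) + \<eta>)"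
          and u' = "\<lambda>t i. u t (i + 1) - 2 * u t i + u t (i - 1) + u t i * f t (u t i) + ?k * z t i"])
      fix t j assume t: "t \<in> {t0..t1}"
      show "0 \<le> u t j + z t j" using nonneg[OF t, of j] z0[of t j] by linarith
      have th: "\<epsilon> \<le> \<theta> t" using t \<eta> by (simp add: \<theta>_def)
      have S0: "0 \<le> S t" using V_pos[of t] by (simp add: S_def)
      have "S t \<le> V t * 1" unfolding S_def using th \<epsilon> V_pos[of t] by (intro mult_left_mono) auto
      then show "S t \<le> \<beta>" using \<beta>[of t] by simp
      show "(S has_real_derivative S t * (f t (V t) + \<eta>)) (at t within {t0..t1})"
        unfolding S_def[abs_def] \<theta>_def
        by (auto intro!: derivative_eq_intros has_field_derivative_at_within[OF V] simp: algebra_simps)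
      have "((\<lambda>t. z t j) has_real_derivative ?k * z t j) (at t within {t0..t1})"
        unfolding z_def by (auto intro!: derivative_eq_intros)
      then show "((\<lambda>t. u t j + z t j) has_real_derivative
          u t (j + 1) - 2 * u t j + u t (j - 1) + u t j * f t (u t j) + ?k * z t j) (at t within {t0..t1})"
        by (intro DERIV_add lattice_solution_deriv[OF u t])
      have "S t * (f t (V t) + \<eta>) \<le> S t * f t (S t)"
        using \<eta>(2)[OF th, of t] S0 by (intro mult_left_mono) (auto simp: S_def)
      then show "S t * (f t (V t) + \<eta>) \<le> S t - 2 * S t + S t + S t * f t (S t)" by simp
      have arith: "(a + z1) - 2 * (b + z0) + (c + z2) + p \<le> a - 2 * b + c + q + k"
        if "p - q \<le> r" "k = r + 2 * z0" "z1 - 2 * z0 + z2 \<le> 2 * z0" for a b c p q r k z0 z1 z2 :: real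
        using that by smt
      have "z t (j + 1) - 2 * z t j + z t (j - 1) = 2 * C * exp (?k * (t - t0))"
        by (simp add: z_def w_def algebra_simps power2_eq_square)
      also have "\<dots> \<le> 2 * C * exp (?k * (t - t0)) * w j"
        using mult_left_mono[of 1 "w j" "2 * C * exp (?k * (t - t0))"] C by (simp add: w_def)
      also have "\<dots> = 2 * z t j" by (simp add: z_def)
      finally have lap: "z t (j + 1) - 2 * z t j + z t (j - 1) \<le> 2 * z t j" .
      have "(u t j + z t j) * f t (u t j + z t j) - u t j * f t (u t j) \<le> growth_bound * z t j"
        using reaction_one_sided[of "u t j" "u t j + z t j" t] nonneg[OF t, of j] z0[of t j] by simp
      moreover have "?k * z t j = growth_bound * z t j + 2 * z t j" by (simp add: distrib_right)
      ultimately show "(u t (j + 1) + z t (j + 1)) - 2 * (u t j + z t j) + (u t (j - 1) + z t (j - 1))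
          + (u t j + z t j) * f t (u t j + z t j)
        \<le> u t (j + 1) - 2 * u t j + u t (j - 1) + u t j * f t (u t j) + ?k * z t j"
        using lap by (intro arith)
    next
      fix j
      have "\<theta>0 \<le> \<eta> * (t1 - t0)" using t01 \<eta> by (simp add: field_simps)
      then have "ln (\<beta> / \<delta>) \<le> \<theta> t0" using \<epsilon> by (simp add: \<theta>_def \<theta>0_def)
      then have "exp (ln (\<beta> / \<delta>)) \<le> exp (\<theta> t0)" by simp
      then have "\<beta> \<le> \<delta> * exp (\<theta> t0)" using \<beta>_pos \<delta> by (simp add: field_simps)
      then have "V t0 \<le> \<delta> * exp (\<theta> t0)" using \<beta>[of t0] by linarith
      then have "S t0 \<le> \<delta>" by (simp add: S_def exp_minus field_simps)
      then show "S t0 \<le> u t0 j + z t0 j" using init[of j] by (simp add: z_def w_def)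
    qed (use le in auto)
    then show "V t1 * exp (- \<epsilon>) \<le> u t1 i + C * exp (?k * (t1 - t0))"
      by (simp add: S_def \<theta>_def z_def w_def)
  qed
qed

text \<open>Boundedness of \<open>V\<close> turns a relative error into an absolute one, uniformly
  in time.\<close>

lemma exp_upper_slack:
  assumes "e > 0"
  shows "\<exists>\<epsilon>>0. \<forall>t. V t * exp \<epsilon> \<le> V t + e"
proof (intro exI[of _ "ln (1 + e / \<beta>)"] conjI allI)
  have "e / \<beta> > 0" using assms \<beta>_pos by simp
  then show "ln (1 + e / \<beta>) > 0" by (intro ln_gt_zero) simp
  fix t
  have "V t * (e / \<beta>) \<le> \<beta> * (e / \<beta>)" using \<beta>[of t] assms \<beta>_pos by (intro mult_right_mono) auto
  then show "V t * exp (ln (1 + e / \<beta>)) \<le> V t + e"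
    using assms \<beta>_pos by (simp add: add_pos_pos algebra_simps)
qed

lemma exp_lower_slack:
  assumes "e > 0"
  shows "\<exists>\<epsilon>>0. \<forall>t. V t - e \<le> V t * exp (- \<epsilon>)"
proof (intro exI[of _ "e / \<beta>"] conjI allI)
  show "e / \<beta> > 0" using assms \<beta>_pos by simp
  fix t
  have "V t * (e / \<beta>) \<le> \<beta> * (e / \<beta>)" using \<beta>[of t] assms \<beta>_pos by (intro mult_right_mono) auto
  moreover have "V t * (1 + - (e / \<beta>)) \<le> V t * exp (- (e / \<beta>))"
    using V_pos[of t] by (intro mult_left_mono exp_ge_add_one_self) simp
  ultimately show "V t - e \<le> V t * exp (- (e / \<beta>))" using \<beta>_pos by (simp add: algebra_simps)
qed

text \<open>The waiting time depends only on the bounds and on \<open>\<epsilon>\<close>. An entire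
  solution can be restarted at \<open>t - \<tau>\<close> for every \<open>t\<close>, so both
  estimates hold at all times with arbitrarily small error; the lower one is used with
  \<open>C = 0\<close>.\<close>

lemma entire_solution_unique:
  assumes U: "lattice_solution f UNIV U" and lower: "\<delta> > 0" "\<And>t i. \<delta> \<le> U t i"
    and upper: "\<And>t i. U t i \<le> B"
  shows "U t i = V t"
proof (rule antisym)
  have U': "lattice_solution f {p..q} U" for p q by (rule lattice_solution_subset[OF U]) simp
  have B: "B > 0" using lower(1) lower(2)[of 0 0] upper[of 0 0] by linarith
  show "U t i \<le> V t"
  proof (rule field_le_epsilon)
    fix e :: real assume "e > 0"
    then obtain \<epsilon> where \<epsilon>: "\<epsilon> > 0" "\<And>t. V t * exp \<epsilon> \<le> V t + e" using exp_upper_slack by blast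
    obtain \<tau> where \<tau>: "\<And>t0 t1 u i. t0 + \<tau> \<le> t1 \<Longrightarrow> lattice_solution f {t0..t1} u \<Longrightarrow>
        (\<And>j. u t0 j \<le> B) \<Longrightarrow> u t1 i \<le> V t1 * exp \<epsilon>"
      by (rule upper_estimate[OF \<epsilon>(1) B]) blast
    have "U t i \<le> V t * exp \<epsilon>" by (rule \<tau>[of "t - \<tau>"]) (use U' upper in auto)
    then show "U t i \<le> V t + e" using \<epsilon>(2)[of t] by linarith
  qed
  show "V t \<le> U t i"
  proof (rule field_le_epsilon)
    fix e :: real assume "e > 0"
    then obtain \<epsilon> where \<epsilon>: "\<epsilon> > 0" "\<And>t. V t - e \<le> V t * exp (- \<epsilon>)" using exp_lower_slack by blast
    obtain \<tau> where \<tau>: "\<And>t0 t1 u i C. t0 + \<tau> \<le> t1 \<Longrightarrow> lattice_solution f {t0..t1} u \<Longrightarrow>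
       (\<And>t j. t \<in> {t0..t1} \<Longrightarrow> 0 \<le> u t j) \<Longrightarrow> 0 \<le> C \<Longrightarrow>
       (\<And>j. \<delta> \<le> u t0 j + C * (1 + (real_of_int (j - i))\<^sup>2)) \<Longrightarrow>
       V t1 * exp (- \<epsilon>) \<le> u t1 i + C * exp ((growth_bound + 2) * (t1 - t0))"
      by (rule lower_estimate[OF \<epsilon>(1) lower(1)]) blast
    have "V t * exp (- \<epsilon>) \<le> U t i + 0 * exp ((growth_bound + 2) * (t - (t - \<tau>)))"
      using U' lower(2) order_trans[OF less_imp_le[OF lower(1)] lower(2)] by (intro \<tau>) auto
    then show "V t \<le> U t i + e" using \<epsilon>(2)[of t] by simp
  qed
qed

section \<open>Convergence bounds uniform in the starting time\<close>

lemma eventually_below: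
  fixes u0 :: linf
  assumes u0: "\<And>i. 0 \<le> u0 i" and e: "e > 0"
  obtains T where "T \<ge> 0" "\<And>s t i. T \<le> t \<Longrightarrow> solution_from f s u0 (t + s) i \<le> V (t + s) + e"
proof -
  obtain \<epsilon> where \<epsilon>: "\<epsilon> > 0" "\<And>t. V t * exp \<epsilon> \<le> V t + e" using exp_upper_slack[OF e] by blast
  \<comment> \<open>The summand \<open>1\<close> keeps the bound strictly positive when
    \<open>u0 = 0\<close>, as \<open>upper_estimate\<close> requires.\<close>
  have "norm u0 + 1 > 0" by (smt (verit) norm_ge_zero)
  then obtain \<tau> where \<tau>: "\<tau> \<ge> 0" "\<And>t0 t1 u i. t0 + \<tau> \<le> t1 \<Longrightarrow> lattice_solution f {t0..t1} u \<Longrightarrow>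
      (\<And>j. u t0 j \<le> norm u0 + 1) \<Longrightarrow> u t1 i \<le> V t1 * exp \<epsilon>"
    by (rule upper_estimate[OF \<epsilon>(1)]) blast
  show ?thesis
  proof (rule that[OF \<tau>(1)])
    fix s t i assume t: "\<tau> \<le> t"
    then have st: "s \<le> t + s" using \<tau>(1) by linarith
    note sol = solution_from_lattice_solution[OF u0 st]
    have "u0 j \<le> norm u0 + 1" for j using abs_linf_le_norm[of u0 j] by linarith
    then have "solution_from f s u0 (t + s) i \<le> V (t + s) * exp \<epsilon>"
      using t by (intro \<tau>(2)[OF _ sol(1)]) (auto simp: sol(2))
    then show "solution_from f s u0 (t + s) i \<le> V (t + s) + e" using \<epsilon>(2)[of "t + s"] by linarith
  qed
qed

lemma eventually_above:
  fixes u0 :: linf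
  assumes u0: "\<And>i. \<delta> \<le> u0 i" and \<delta>: "\<delta> > 0" and e: "e > 0"
  obtains T where "T \<ge> 0" "\<And>s t i. T \<le> t \<Longrightarrow> V (t + s) - e \<le> solution_from f s u0 (t + s) i"
proof -
  obtain \<epsilon> where \<epsilon>: "\<epsilon> > 0" "\<And>t. V t - e \<le> V t * exp (- \<epsilon>)" using exp_lower_slack[OF e] by blast
  obtain \<tau> where \<tau>: "\<tau> \<ge> 0" "\<And>t0 t1 u i C. t0 + \<tau> \<le> t1 \<Longrightarrow> lattice_solution f {t0..t1} u \<Longrightarrow>
       (\<And>t j. t \<in> {t0..t1} \<Longrightarrow> 0 \<le> u t j) \<Longrightarrow> 0 \<le> C \<Longrightarrow>
       (\<And>j. \<delta> \<le> u t0 j + C * (1 + (real_of_int (j - i))\<^sup>2)) \<Longrightarrow>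
       V t1 * exp (- \<epsilon>) \<le> u t1 i + C * exp ((growth_bound + 2) * (t1 - t0))"
    by (rule lower_estimate[OF \<epsilon>(1) \<delta>]) blast
  have u0': "0 \<le> u0 i" for i using u0[of i] \<delta> by linarith
  show ?thesis
  proof (rule that[OF \<tau>(1)])
    fix s t i assume t: "\<tau> \<le> t"
    then have st: "s \<le> t + s" using \<tau>(1) by linarith
    note sol = solution_from_lattice_solution[OF u0' st]
    have "V (t + s) * exp (- \<epsilon>) \<le> solution_from f s u0 (t + s) i + 0 * exp ((growth_bound + 2) * (t + s - s))"
      using t u0 sol(3) by (intro \<tau>(2)[OF _ sol(1)]) (auto simp: sol(2))
    then show "V (t + s) - e \<le> solution_from f s u0 (t + s) i" using \<epsilon>(2)[of "t + s"] by simp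
  qed
qed

text \<open>The lower estimate is restarted at \<open>t - \<tau>\<close>. A site within
  \<open>\<gamma> * t\<close> is then at distance at least
  \<open>R = \<gamma>' * (t - \<tau>) - \<gamma> * t\<close> from every site outside the window, and
  \<open>C = \<delta> / (1 + R\<^sup>2)\<close> makes up for the missing lower bound there. Its cost
  over the fixed time \<open>\<tau>\<close> tends to \<open>0\<close>. As \<open>T\<close> precedes
  \<open>s\<close>, the same lemma serves one starting time and all of them.\<close>

lemma eventually_above_window:
  fixes u0 :: linf
  assumes u0: "\<And>i. 0 \<le> u0 i" and \<delta>: "\<delta> > 0" and \<gamma>: "0 < \<gamma>" "\<gamma> < \<gamma>'" and e: "e > 0"
  obtains T where "\<And>s t i.
    (\<And>t i. T0 \<le> t \<Longrightarrow> i \<in> sites_within (\<gamma>' * t) \<Longrightarrow> \<delta> \<le> solution_from f s u0 (t + s) i) \<Longrightarrow>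
    T \<le> t \<Longrightarrow> i \<in> sites_within (\<gamma> * t) \<Longrightarrow> V (t + s) - e \<le> solution_from f s u0 (t + s) i"
proof -
  have "e / 2 > 0" using e by simp
  then obtain \<epsilon> where \<epsilon>: "\<epsilon> > 0" "\<And>t. V t - e / 2 \<le> V t * exp (- \<epsilon>)" using exp_lower_slack by blast
  obtain \<tau> where \<tau>: "\<tau> \<ge> 0" "\<And>t0 t1 u i C. t0 + \<tau> \<le> t1 \<Longrightarrow> lattice_solution f {t0..t1} u \<Longrightarrow>
       (\<And>t j. t \<in> {t0..t1} \<Longrightarrow> 0 \<le> u t j) \<Longrightarrow> 0 \<le> C \<Longrightarrow>
       (\<And>j. \<delta> \<le> u t0 j + C * (1 + (real_of_int (j - i))\<^sup>2)) \<Longrightarrow>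
       V t1 * exp (- \<epsilon>) \<le> u t1 i + C * exp ((growth_bound + 2) * (t1 - t0))"
    by (rule lower_estimate[OF \<epsilon>(1) \<delta>]) blast
  define D where "D = exp ((growth_bound + 2) * \<tau>)"
  have D: "D > 0" by (simp add: D_def)
  \<comment> \<open>A distance \<open>R \<ge> R1\<close> makes the cost \<open>C * D\<close> at most
    \<open>e / 2\<close>. The first entry of \<open>T\<close> below ensures that
    \<open>t - \<tau>\<close> is at least \<open>T0\<close> and nonnegative, the second that
    \<open>R1 \<le> R\<close>.\<close>
  define R1 where "R1 = 2 * \<delta> * D / e"
  have R1: "R1 > 0" using \<delta> D e by (simp add: R1_def)
  define T where "T = max (max T0 0 + \<tau>) ((R1 + \<gamma>' * \<tau>) / (\<gamma>' - \<gamma>))"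
  show ?thesis
  proof (rule that[of T])
    fix s t i
    assume low: "\<And>t i. T0 \<le> t \<Longrightarrow> i \<in> sites_within (\<gamma>' * t) \<Longrightarrow> \<delta> \<le> solution_from f s u0 (t + s) i"
      and t: "T \<le> t" and i: "i \<in> sites_within (\<gamma> * t)"
    define R where "R = \<gamma>' * (t - \<tau>) - \<gamma> * t"
    have "(R1 + \<gamma>' * \<tau>) / (\<gamma>' - \<gamma>) \<le> t" using t by (simp add: T_def)
    then have R: "R1 \<le> R" using \<gamma> by (simp add: R_def field_simps)
    have t': "T0 \<le> t - \<tau>" "0 \<le> t - \<tau>" using t by (auto simp: T_def)
    then have st: "s \<le> t + s" using \<tau>(1) by linarith
    note sol = solution_from_lattice_solution[OF u0 st]
    let ?t0 = "(t - \<tau>) + s"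
    define C where "C = \<delta> / (1 + R\<^sup>2)"
    have R2: "1 + R\<^sup>2 > 0" by (simp add: add_pos_nonneg)
    have "V (t + s) * exp (- \<epsilon>) \<le> solution_from f s u0 (t + s) i
        + C * exp ((growth_bound + 2) * (t + s - ?t0))"
    proof (rule \<tau>(2))
      show "lattice_solution f {?t0..t + s} (solution_from f s u0)"
        by (rule lattice_solution_subset[OF sol(1)]) (use t' in auto)
      show "0 \<le> C" using \<delta> R2 by (simp add: C_def)
      show "0 \<le> solution_from f s u0 t' j" if "t' \<in> {?t0..t + s}" for t' j
        using sol(3)[of t' j] that t' by auto
      fix j
      show "\<delta> \<le> solution_from f s u0 ?t0 j + C * (1 + (real_of_int (j - i))\<^sup>2)"
      proof (cases "j \<in> sites_within (\<gamma>' * (t - \<tau>))")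
        case True
        then have "\<delta> \<le> solution_from f s u0 ?t0 j" using low[OF t'(1)] by simp
        moreover have "0 \<le> C * (1 + (real_of_int (j - i))\<^sup>2)" using \<open>0 \<le> C\<close> by simp
        ultimately show ?thesis by linarith
      next
        case False
        have "R \<le> \<bar>real_of_int (j - i)\<bar>"
          using False i by (simp add: sites_within_def R_def)
        then have "R\<^sup>2 \<le> (real_of_int (j - i))\<^sup>2" using R R1 by (simp flip: abs_le_square_iff)
        then have "C * (1 + R\<^sup>2) \<le> C * (1 + (real_of_int (j - i))\<^sup>2)"
          using \<open>0 \<le> C\<close> by (intro mult_left_mono) auto
        moreover have "C * (1 + R\<^sup>2) = \<delta>" using R2 by (simp add: C_def)
        moreover have "0 \<le> solution_from f s u0 ?t0 j" using sol(3)[of ?t0 j] t' \<tau>(1) by auto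
        ultimately show ?thesis by linarith
      qed
    qed simp
    also have "C * exp ((growth_bound + 2) * (t + s - ?t0)) = C * D" by (simp add: D_def algebra_simps)
    also have "C * D \<le> e / 2"
    proof -
      have "2 * R \<le> 1 + R\<^sup>2" using sum_squares_bound[of 1 R] by simp
      then have "R1 \<le> 1 + R\<^sup>2" using R R1 by linarith
      then have "2 * \<delta> * D \<le> e * (1 + R\<^sup>2)" using e by (simp add: R1_def field_simps)
      then show ?thesis using R2 by (simp add: C_def field_simps)
    qed
    finally show "V (t + s) - e \<le> solution_from f s u0 (t + s) i" using \<epsilon>(2)[of "t + s"] by linarith
  qed
qed

end

section \<open>Uniqueness, stability and spreading in terms of limits\<close>

lemma zero_in_sites_within: "0 \<le> r \<Longrightarrow> 0 \<in> sites_within r"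
  by (simp add: sites_within_def)

lemma INF_ereal_pos_lower_bound:
  assumes "(INF i. ereal (g i)) > 0"
  obtains \<delta> where "\<delta> > 0" "\<And>i. \<delta> \<le> g i"
proof -
  obtain \<delta> where \<delta>: "0 < ereal \<delta>" "ereal \<delta> < (INF i. ereal (g i))" using ereal_dense2[OF assms] by blast
  have "\<delta> \<le> g i" for i using less_INF_D[OF \<delta>(2) UNIV_I, of i] by simp
  then show ?thesis using that[of \<delta>] \<delta>(1) by simp
qed

context kpp_entire
begin

lemma window_estimate:
  fixes u0 :: linf
  assumes u0: "\<And>i. 0 \<le> u0 i" and \<delta>: "\<delta> > 0" and \<gamma>: "0 < \<gamma>" "\<gamma> < \<gamma>'" and e: "e > 0"
  obtains T where "T \<ge> 0" "\<And>s t i.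
    (\<And>t i. T0 \<le> t \<Longrightarrow> i \<in> sites_within (\<gamma>' * t) \<Longrightarrow> \<delta> \<le> solution_from f s u0 (t + s) i) \<Longrightarrow>
    T \<le> t \<Longrightarrow> i \<in> sites_within (\<gamma> * t) \<Longrightarrow> \<bar>solution_from f s u0 (t + s) i - V (t + s)\<bar> \<le> e"
proof -
  obtain T1 where T1: "T1 \<ge> 0"
    "\<And>s t i. T1 \<le> t \<Longrightarrow> solution_from f s u0 (t + s) i \<le> V (t + s) + e"
    by (rule eventually_below[OF u0 e]) blast
  obtain T2 where T2: "\<And>s t i.
    (\<And>t i. T0 \<le> t \<Longrightarrow> i \<in> sites_within (\<gamma>' * t) \<Longrightarrow> \<delta> \<le> solution_from f s u0 (t + s) i) \<Longrightarrow>
    T2 \<le> t \<Longrightarrow> i \<in> sites_within (\<gamma> * t) \<Longrightarrow> V (t + s) - e \<le> solution_from f s u0 (t + s) i"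
    by (rule eventually_above_window[OF u0 \<delta> \<gamma> e, of T0]) blast
  show ?thesis
  proof (rule that[of "max T1 T2"])
    show "0 \<le> max T1 T2" using T1(1) by simp
    fix s t i
    assume low: "\<And>t i. T0 \<le> t \<Longrightarrow> i \<in> sites_within (\<gamma>' * t) \<Longrightarrow> \<delta> \<le> solution_from f s u0 (t + s) i"
      and t: "max T1 T2 \<le> t" and i: "i \<in> sites_within (\<gamma> * t)"
    have "V (t + s) - e \<le> solution_from f s u0 (t + s) i" by (rule T2[OF low _ i]) (use t in auto)
    moreover have "solution_from f s u0 (t + s) i \<le> V (t + s) + e" using T1(2) t by simp
    ultimately show "\<bar>solution_from f s u0 (t + s) i - V (t + s)\<bar> \<le> e" by linarith
  qed
qed

lemma homogeneous_entire_solution: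
  "entire_positive_solution f (\<lambda>t. const_bcontfun (V t))"
  "spatially_homogeneous (\<lambda>t. const_bcontfun (V t))"
proof -
  have "ereal \<alpha> \<le> (INF t. INF i. ereal (apply_bcontfun (const_bcontfun (V t) :: linf) i))"
    using \<alpha>(2) by (intro INF_greatest) simp
  moreover have "0 < ereal \<alpha>" using \<alpha>(1) by simp
  ultimately have "0 < (INF t. INF i. ereal (apply_bcontfun (const_bcontfun (V t) :: linf) i))"
    by (metis less_le_trans)
  then show "entire_positive_solution f (\<lambda>t. const_bcontfun (V t))"
    using lattice_solution_const[of UNIV V f] V by (simp add: entire_positive_solution_def)
  show "spatially_homogeneous (\<lambda>t. const_bcontfun (V t))" by (simp add: spatially_homogeneous_def)
qed

text \<open>The definition of an entire positive solution supplies only the lower bound. Homogeneity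
  removes the diffusion term, and the scalar equation then supplies the upper bound that
  \<open>entire_solution_unique\<close> takes.\<close>

lemma homogeneous_entire_solution_eq:
  assumes "entire_positive_solution f U" "spatially_homogeneous U"
  shows "U t i = V t"
proof -
  have U: "lattice_solution f UNIV U" and pos: "(INF t. INF i. ereal (U t i)) > 0"
    using assms(1) by (auto simp: entire_positive_solution_def)
  have hom: "U t i = U t 0" for t i using assms(2) unfolding spatially_homogeneous_def by blast
  obtain \<delta> where "0 < ereal \<delta>" "ereal \<delta> < (INF t. INF i. ereal (U t i))"
    using ereal_dense2[OF pos] by blast
  then have \<delta>: "\<delta> > 0" "\<delta> \<le> U t i" for t i
    by (auto dest!: less_INF_D[where i = t] less_INF_D[where i = i])
  have d: "((\<lambda>t. U t 0) has_real_derivative U t 0 * f t (U t 0)) (at t)" for t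
    using lattice_solution_deriv[OF U, of t 0] hom[of t 1] hom[of t "-1"] by simp
  have "U t 0 > 0" for t using \<delta>(1) \<delta>(2)[of t 0] by linarith
  then obtain B where B: "\<And>t. U t 0 \<le> B" using entire_scalar_solution_bounded[OF d] by blast
  have "U t i \<le> B" for t i using B[of t] hom[of t i] by simp
  then show ?thesis by (rule entire_solution_unique[OF U \<delta>])
qed

lemma stability:
  fixes u0 :: linf
  assumes "(INF i. ereal (u0 i)) > 0"
  shows "uniform_limit UNIV (\<lambda>t s. norm (solution_from f s u0 (t + s) - const_bcontfun (V (t + s))))
    (\<lambda>s. 0) at_top"
proof (rule uniform_limitI)
  fix e :: real assume "e > 0"
  then have e: "e / 2 > 0" by simp
  obtain \<delta> where \<delta>: "\<delta> > 0" "\<And>i. \<delta> \<le> u0 i" by (rule INF_ereal_pos_lower_bound[OF assms]) blast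
  have u0: "0 \<le> u0 i" for i using \<delta>(1) \<delta>(2)[of i] by linarith
  obtain T1 where T1: "\<And>s t i. T1 \<le> t \<Longrightarrow> solution_from f s u0 (t + s) i \<le> V (t + s) + e / 2"
    by (rule eventually_below[OF u0 e]) blast
  obtain T2 where T2: "\<And>s t i. T2 \<le> t \<Longrightarrow> V (t + s) - e / 2 \<le> solution_from f s u0 (t + s) i"
    by (rule eventually_above[OF \<delta>(2,1) e]) blast
  show "\<forall>\<^sub>F t in at_top. \<forall>s\<in>UNIV.
      dist (norm (solution_from f s u0 (t + s) - const_bcontfun (V (t + s)))) 0 < e"
    using eventually_ge_at_top[of T1] eventually_ge_at_top[of T2]
  proof eventually_elim
    case (elim t)
    have "norm (solution_from f s u0 (t + s) - const_bcontfun (V (t + s))) \<le> e / 2" for s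
    proof (rule norm_bound)
      fix i
      show "norm (apply_bcontfun (solution_from f s u0 (t + s) - const_bcontfun (V (t + s))) i) \<le> e / 2"
        unfolding minus_bcontfun.rep_eq const_bcontfun.rep_eq real_norm_def
        using T1[OF elim(1), of s i] T2[OF elim(2), of s i] by linarith
    qed
    then have "norm (solution_from f s u0 (t + s) - const_bcontfun (V (t + s))) < e" for s
      by (rule le_less_trans) (simp add: \<open>e > 0\<close>)
    then show ?case by (simp add: dist_real_def)
  qed
qed

lemma spreading_from_zero:
  fixes u0 :: linf
  assumes u0: "\<And>i. 0 \<le> u0 i" and \<gamma>: "0 < \<gamma>" "\<gamma> < \<gamma>'"
    and low: "Liminf at_top (\<lambda>t. INF i\<in>sites_within (\<gamma>' * t). ereal (solution_from f 0 u0 t i)) > 0"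
  shows "Limsup at_top (\<lambda>t. SUP i\<in>sites_within (\<gamma> * t).
    ereal \<bar>solution_from f 0 u0 t i - V t\<bar>) = 0" (is "Limsup at_top ?S = 0")
proof (rule antisym)
  obtain \<delta> where \<delta>: "0 < ereal \<delta>"
    "ereal \<delta> < Liminf at_top (\<lambda>t. INF i\<in>sites_within (\<gamma>' * t). ereal (solution_from f 0 u0 t i))"
    using ereal_dense2[OF low] by blast
  obtain T0 where T0: "\<And>t. T0 \<le> t \<Longrightarrow> ereal \<delta> < (INF i\<in>sites_within (\<gamma>' * t). ereal (solution_from f 0 u0 t i))"
    using less_LiminfD[OF \<delta>(2)] unfolding eventually_at_top_linorder by blast
  have low': "\<delta> \<le> solution_from f 0 u0 (t + 0) i" if "T0 \<le> t" "i \<in> sites_within (\<gamma>' * t)" for t i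
    using less_INF_D[OF T0[OF that(1)] that(2)] by simp
  show "Limsup at_top ?S \<le> 0"
  proof (rule ereal_le_epsilon2)
    fix e :: real assume e: "e > 0"
    obtain T where T: "\<And>s t i.
      (\<And>t i. T0 \<le> t \<Longrightarrow> i \<in> sites_within (\<gamma>' * t) \<Longrightarrow> \<delta> \<le> solution_from f s u0 (t + s) i) \<Longrightarrow>
      T \<le> t \<Longrightarrow> i \<in> sites_within (\<gamma> * t) \<Longrightarrow> \<bar>solution_from f s u0 (t + s) i - V (t + s)\<bar> \<le> e"
      by (rule window_estimate[OF u0 _ \<gamma> e, of \<delta> T0]) (use \<delta>(1) in auto)
    have "?S t \<le> ereal e" if "T \<le> t" for t
      using T[of 0, OF low' that] by (intro SUP_least) simp
    then have "Limsup at_top ?S \<le> ereal e"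
      by (intro Limsup_bounded) (auto simp: eventually_at_top_linorder)
    then show "Limsup at_top ?S \<le> 0 + ereal e" by simp
  qed
  \<comment> \<open>An extended supremum over an empty window would be minus infinity; for
    \<open>t \<ge> 0\<close> the window contains site \<open>0\<close>.\<close>
  show "0 \<le> Limsup at_top ?S"
  proof (rule le_Limsup)
    show "\<forall>\<^sub>F t in at_top. 0 \<le> ?S t"
      using eventually_ge_at_top[of 0]
    proof eventually_elim
      case (elim t)
      then have "0 \<in> sites_within (\<gamma> * t)" using \<gamma> by (intro zero_in_sites_within) simp
      then show ?case by (rule SUP_upper2) simp
    qed
  qed simp
qed

lemma spreading_uniform:
  fixes u0 :: linf
  assumes u0: "\<And>i. 0 \<le> u0 i" and \<gamma>: "0 < \<gamma>" "\<gamma> < \<gamma>'"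
    and low: "Liminf at_top (\<lambda>t. INF s. INF i\<in>sites_within (\<gamma>' * t).
      ereal (solution_from f s u0 (t + s) i)) > 0"
  shows "uniform_limit UNIV (\<lambda>t s. SUP i\<in>sites_within (\<gamma> * t).
    \<bar>solution_from f s u0 (t + s) i - V (t + s)\<bar>) (\<lambda>s. 0) at_top"
proof (rule uniform_limitI)
  obtain \<delta> where \<delta>: "0 < ereal \<delta>"
    "ereal \<delta> < Liminf at_top (\<lambda>t. INF s. INF i\<in>sites_within (\<gamma>' * t). ereal (solution_from f s u0 (t + s) i))"
    using ereal_dense2[OF low] by blast
  obtain T0 where T0: "\<And>t. T0 \<le> t \<Longrightarrow>
      ereal \<delta> < (INF s. INF i\<in>sites_within (\<gamma>' * t). ereal (solution_from f s u0 (t + s) i))"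
    using less_LiminfD[OF \<delta>(2)] unfolding eventually_at_top_linorder by blast
  have low': "\<delta> \<le> solution_from f s u0 (t + s) i" if "T0 \<le> t" "i \<in> sites_within (\<gamma>' * t)" for s t i
    using less_INF_D[OF less_INF_D[OF T0[OF that(1)] UNIV_I] that(2), of s] by simp
  fix e :: real assume e: "e > 0"
  then have e2: "e / 2 > 0" by simp
  obtain T where T: "T \<ge> 0" "\<And>s t i.
    (\<And>t i. T0 \<le> t \<Longrightarrow> i \<in> sites_within (\<gamma>' * t) \<Longrightarrow> \<delta> \<le> solution_from f s u0 (t + s) i) \<Longrightarrow>
    T \<le> t \<Longrightarrow> i \<in> sites_within (\<gamma> * t) \<Longrightarrow> \<bar>solution_from f s u0 (t + s) i - V (t + s)\<bar> \<le> e / 2"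
    by (rule window_estimate[OF u0 _ \<gamma> e2, of \<delta> T0]) (use \<delta>(1) in auto)
  show "\<forall>\<^sub>F t in at_top. \<forall>s\<in>UNIV. dist (SUP i\<in>sites_within (\<gamma> * t).
      \<bar>solution_from f s u0 (t + s) i - V (t + s)\<bar>) 0 < e"
    using eventually_ge_at_top[of T]
  proof eventually_elim
    case (elim t)
    \<comment> \<open>The real supremum is only meaningful over a nonempty window;
      \<open>T \<ge> 0\<close> guarantees this for all \<open>t \<ge> T\<close>.\<close>
    have zero: "0 \<in> sites_within (\<gamma> * t)" using \<gamma> elim T(1) by (intro zero_in_sites_within) simp
    show ?case
    proof
      fix s
      let ?g = "\<lambda>i. \<bar>solution_from f s u0 (t + s) i - V (t + s)\<bar>"
      have g: "?g i \<le> e / 2" if "i \<in> sites_within (\<gamma> * t)" for i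
        by (rule T(2)[OF low' elim that])
      then have "(SUP i\<in>sites_within (\<gamma> * t). ?g i) \<le> e / 2" using zero by (intro cSUP_least) auto
      moreover have "bdd_above (?g ` sites_within (\<gamma> * t))" using g by (rule bdd_aboveI2)
      then have "0 \<le> (SUP i\<in>sites_within (\<gamma> * t). ?g i)" by (rule cSUP_upper2[OF _ zero]) simp
      ultimately show "dist (SUP i\<in>sites_within (\<gamma> * t). ?g i) 0 < e" using e by simp
    qed
  qed
qed

end

theorem theorem1p1:
  fixes f :: "real \<Rightarrow> real \<Rightarrow> real"
  assumes "KPP_a f" and "KPP_b f" and "KPP_c f"
  shows
    "(\<exists>!U. entire_positive_solution f U \<and> spatially_homogeneous U) \<and>
     (\<forall>U. entire_positive_solution f U \<and> spatially_homogeneous U \<longrightarrow>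
        (\<forall>u0 :: linf. (INF i. ereal (apply_bcontfun u0 i)) > 0 \<longrightarrow>
           uniform_limit UNIV (\<lambda>t s. norm (solution_from f s u0 (t + s) - U (t + s)))
             (\<lambda>s. 0) at_top) \<and>
        (\<forall>(u0 :: linf) (\<gamma>' :: real). (\<forall>i. apply_bcontfun u0 i \<ge> 0) \<and> \<gamma>' > 0 \<longrightarrow>
           (Liminf at_top (\<lambda>t. INF i\<in>sites_within (\<gamma>' * t).
                ereal (solution_from f 0 u0 t i)) > 0 \<longrightarrow>
              (\<forall>\<gamma>. 0 < \<gamma> \<and> \<gamma> < \<gamma>' \<longrightarrow>
                 Limsup at_top (\<lambda>t. SUP i\<in>sites_within (\<gamma> * t).
                   ereal \<bar>solution_from f 0 u0 t i - U t i\<bar>) = 0)) \<and>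
           (Liminf at_top (\<lambda>t. INF s. INF i\<in>sites_within (\<gamma>' * t).
                ereal (solution_from f s u0 (t + s) i)) > 0 \<longrightarrow>
              (\<forall>\<gamma>. 0 < \<gamma> \<and> \<gamma> < \<gamma>' \<longrightarrow>
                 uniform_limit UNIV
                   (\<lambda>t s. SUP i\<in>sites_within (\<gamma> * t).
                      \<bar>solution_from f s u0 (t + s) i - U (t + s) i\<bar>)
                   (\<lambda>s. 0) at_top))))"
proof -
  interpret kpp f by unfold_locales (fact assms)+
  obtain V \<alpha> \<beta> where "0 < \<alpha>" "\<And>t. (V has_real_derivative V t * f t (V t)) (at t)"
    "\<And>t. \<alpha> \<le> V t" "\<And>t. V t \<le> \<beta>"
    by (rule entire_scalar_solution_exists) blast
  then interpret kpp_entire f V \<alpha> \<beta> by unfold_locales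
  define W :: "real \<Rightarrow> linf" where "W t = const_bcontfun (V t)" for t
  have W: "entire_positive_solution f W \<and> spatially_homogeneous W"
    using homogeneous_entire_solution by (simp add: W_def[abs_def])
  \<comment> \<open>This settles uniqueness and also reduces the claims quantified over
    \<open>U\<close> to the single solution \<open>W\<close>.\<close>
  have eq: "U = W" if "entire_positive_solution f U \<and> spatially_homogeneous U" for U
    using homogeneous_entire_solution_eq that by (auto simp: W_def intro!: ext bcontfun_eqI)
  have W_apply: "W t i = V t" for t i by (simp add: W_def)
  show ?thesis
  proof (rule conjI, rule ex1I[of _ W], rule W, erule eq, intro allI impI, drule eq, simp only:, intro conjI allI impI)
    fix u0 :: linf
    assume "(INF i. ereal (apply_bcontfun u0 i)) > 0"
    then show "uniform_limit UNIV (\<lambda>t s. norm (solution_from f s u0 (t + s) - W (t + s))) (\<lambda>s. 0) at_top"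
      unfolding W_def by (rule stability)
  next
    fix u0 :: linf and \<gamma>' \<gamma> :: real
    assume "(\<forall>i. apply_bcontfun u0 i \<ge> 0) \<and> \<gamma>' > 0"
      "Liminf at_top (\<lambda>t. INF i\<in>sites_within (\<gamma>' * t). ereal (solution_from f 0 u0 t i)) > 0"
      "0 < \<gamma> \<and> \<gamma> < \<gamma>'"
    then show "Limsup at_top (\<lambda>t. SUP i\<in>sites_within (\<gamma> * t).
        ereal \<bar>solution_from f 0 u0 t i - W t i\<bar>) = 0"
      unfolding W_apply by (intro spreading_from_zero) auto
  next
    fix u0 :: linf and \<gamma>' \<gamma> :: real
    assume "(\<forall>i. apply_bcontfun u0 i \<ge> 0) \<and> \<gamma>' > 0"
      "Liminf at_top (\<lambda>t. INF s. INF i\<in>sites_within (\<gamma>' * t).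
         ereal (solution_from f s u0 (t + s) i)) > 0"
      "0 < \<gamma> \<and> \<gamma> < \<gamma>'"
    then show "uniform_limit UNIV (\<lambda>t s. SUP i\<in>sites_within (\<gamma> * t).
        \<bar>solution_from f s u0 (t + s) i - W (t + s) i\<bar>) (\<lambda>s. 0) at_top"
      unfolding W_apply by (intro spreading_uniform) auto
  qed
qed

end
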